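(* Let $\mathbb{D}\subset\mathbb{R}^2$ be the closed unit disk. For any compact convex set $X\subset\mathbb{R}^2$ with perimeter $\ell(\partial X)=2\pi$ such that $X$ is not a disk, there exists $\epsilon>0$ such that $P_X(l)<P_{\mathbb{D}}(l)$ for all $l\in(0,\epsilon)$.
   Context: For $x\in\mathbb{R}^2$ and $l>0$, a random needle of length $l$ at $x$ is the directed line segment of length $l$ starting at $x$ whose angle with the horizontal axis is chosen uniformly from $[0,2\pi)$; a random needle of length $0$ at $x$ is the point $x$. For a bounded convex set $X\subset\mathbb{R}^2$, the pointwise probability $p_X(x,l)$ (for $x\in X$, $l\ge 0$) is the probability that a random needle of length $l$ at $x$ lies entirely within $X$. The Buffon probability $P_X(l)$ is the probability that a random needle of length $l$ at a point $x$ chosen uniformly from $X$ lies entirely within $X$, i.e. $P_X(l)=\frac{1}{\mathcal{A}(X)}\int_X p_X(x,l)\,dx$, where $\mathcal{A}$ denotes area. $\ell$ denotes length, so $\ell(\partial X)$ is the perimeter of $X$. *)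

theory Defs
  imports "HOL-Analysis.Analysis"
begin

definition variation_sums :: "(real \<Rightarrow> 'a::metric_space) \<Rightarrow> real set" where
  "variation_sums g = {(\<Sum>i<n. dist (g (t (Suc i))) (g (t i))) | n t.
      t 0 = 0 \<and> t n = 1 \<and> (\<forall>i<n. t i \<le> t (Suc i))}"

definition has_curve_length :: "(real \<Rightarrow> 'a::metric_space) \<Rightarrow> real \<Rightarrow> bool" where
  "has_curve_length g L \<longleftrightarrow> bdd_above (variation_sums g) \<and> Sup (variation_sums g) = L"

definition boundary_length :: "(real^2) set \<Rightarrow> real \<Rightarrow> bool" where
  "boundary_length X L \<longleftrightarrow> (\<exists>g. simple_path g \<and> pathfinish g = pathstart g \<and>
      path_image g = frontier X \<and> has_curve_length g L)"

definition needle :: "real^2 \<Rightarrow> real \<Rightarrow> real \<Rightarrow> (real^2) set" where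
  "needle x l \<theta> = closed_segment x (x + l *\<^sub>R vector [cos \<theta>, sin \<theta>])"

definition pointwise_prob :: "(real^2) set \<Rightarrow> real^2 \<Rightarrow> real \<Rightarrow> real" where
  "pointwise_prob X x l = measure lebesgue {\<theta> \<in> {0..<2*pi}. needle x l \<theta> \<subseteq> X} / (2*pi)"

definition buffon_prob :: "(real^2) set \<Rightarrow> real \<Rightarrow> real" where
  "buffon_prob X l = integral X (\<lambda>x. pointwise_prob X x l) / measure lebesgue X"

end

theory Submission
  imports Defs "HOL-Real_Asymp.Real_Asymp"
begin

text \<open>
  Write \<open>A\<close> for the area of \<open>X\<close>, \<open>h\<close> for its support function and \<open>I\<close> for the integral of \<open>h\<close>
  over a full turn. By Fubini, \<open>2\<pi>A(1 - P\<^sub>X(l))\<close> is the integral over \<open>\<theta>\<close> of the area lost when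
  intersecting \<open>X\<close> with its translate by \<open>-l u\<^sub>\<theta>\<close>. To first order in \<open>l\<close> this area is \<open>l\<close> times the
  width of \<open>X\<close> orthogonal to \<open>u\<^sub>\<theta>\<close>, so \<open>P\<^sub>X(l)\<close> is at most \<open>1 - lI/(\<pi>A) + O(l\<^sup>2)\<close>, whereas the disk has
  \<open>P(l) \<ge> 1 - 2l/\<pi>\<close>. It remains to see that \<open>2A < I\<close>.

  Projecting fine inscribed polygons of the boundary curve to all directions gives \<open>I \<le> 2\<pi>\<close>, and
  \<open>4\<pi>A < I\<^sup>2\<close> holds unless \<open>X\<close> is a disk: the area of the circumscribed polygon with \<open>n\<close>
  equiangular normals is a quadratic form in the sampled values of \<open>h\<close>, which a discrete Wirtinger
  inequality (via the discrete Fourier transform) bounds by the square of their mean, with a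
  deficit controlled by the distance of \<open>h\<close> to the span of \<open>1, cos, sin\<close>; then let \<open>n \<rightarrow> \<infinity>\<close>.
\<close>

section \<open>Directions, boxes and support functions\<close>

definition dir :: "real \<Rightarrow> real^2" where
  "dir \<theta> = vector [cos \<theta>, sin \<theta>]"

lemma inner_real2: "(x::real^2) \<bullet> y = x$1 * y$1 + x$2 * y$2"
  by (simp add: inner_vec_def sum_2)

lemma dir_nth [simp]: "dir \<theta> $ 1 = cos \<theta>" "dir \<theta> $ 2 = sin \<theta>"
  by (simp_all add: dir_def)

lemma inner_dir: "x \<bullet> dir \<theta> = x$1 * cos \<theta> + x$2 * sin \<theta>"
  by (simp add: inner_real2)

lemma inner_dir_dir: "dir \<alpha> \<bullet> dir \<beta> = cos (\<alpha> - \<beta>)"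
  by (simp add: inner_dir cos_diff)

lemma norm_dir [simp]: "norm (dir \<theta>) = 1"
  by (simp add: norm_eq_sqrt_inner inner_dir_dir)

lemma dir_pi: "dir (\<theta> + pi) = - dir \<theta>"
  by (simp add: vec_eq_iff forall_2)

lemma dir_2pi: "dir (\<theta> + 2 * pi) = dir \<theta>"
  by (simp add: vec_eq_iff forall_2)

lemma polar_real2: "\<exists>\<phi>\<in>{0..2*pi}. (x::real^2) = norm x *\<^sub>R dir \<phi>"
proof -
  define z where "z = Complex (x$1) (x$2)"
  have n: "cmod z = norm x"
    by (simp add: z_def cmod_def norm_eq_sqrt_inner inner_real2 power2_eq_square)
  have "z = rcis (cmod z) (Arg2pi z)"
    using Arg2pi_eq[of z] by (simp add: rcis_def cis_conv_exp)
  then have "Re z = cmod z * cos (Arg2pi z)" "Im z = cmod z * sin (Arg2pi z)"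
    by (metis Re_rcis, metis Im_rcis)
  then have "x = norm x *\<^sub>R dir (Arg2pi z)"
    by (simp add: vec_eq_iff forall_2 n) (simp add: z_def)
  moreover have "Arg2pi z \<in> {0..2*pi}"
    using Arg2pi_ge_0[of z] Arg2pi_lt_2pi[of z] by simp
  ultimately show ?thesis by blast
qed

text \<open>The columns of \<open>matrix g\<close> are \<open>a\<close> and \<open>b\<close>, so the
  area is scaled by the absolute value of their determinant. Rotated rectangles and the long
  parallelogram in \<open>measure_shift_loss_ge\<close> are both obtained this way.\<close>

lemma linear_combination_image_measure:
  fixes a b c d :: "real^2"
  defines "g \<equiv> \<lambda>y::real^2. y$1 *\<^sub>R a + y$2 *\<^sub>R b"
  shows "g ` cbox c d \<in> lmeasurable"
    and "measure lebesgue (g ` cbox c d) = \<bar>a$1 * b$2 - a$2 * b$1\<bar> * measure lebesgue (cbox c d)"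
proof -
  have lin: "linear g"
    unfolding g_def by (rule linearI) (simp_all add: algebra_simps)
  have "matrix g = (\<chi> i j. if j = 1 then a$i else b$i)"
    by (simp add: matrix_def g_def vec_eq_iff forall_2 axis_def)
  then have det: "det (matrix g) = a$1 * b$2 - a$2 * b$1"
    by (simp add: det_2 algebra_simps)
  show "g ` cbox c d \<in> lmeasurable"
    by (rule measurable_linear_image[OF lin]) simp
  show "measure lebesgue (g ` cbox c d) = \<bar>a$1 * b$2 - a$2 * b$1\<bar> * measure lebesgue (cbox c d)"
    using measure_linear_image[OF lin, of "cbox c d"] by (simp add: det)
qed

lemma measure_cbox_real2:
  fixes a b c d :: real
  assumes "a \<le> b" "c \<le> d"
  shows "measure lebesgue (cbox (vector [a, c]) (vector [b, d]) :: (real^2) set) = (b - a) * (d - c)"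
proof -
  have "cbox (vector [a, c]) (vector [b, d] :: real^2) \<noteq> {}"
    using assms by (simp add: interval_ne_empty_cart forall_2)
  then show ?thesis
    by (simp add: content_cbox_cart UNIV_2)
qed

text \<open>Since \<open>dir (\<theta> + pi/2)\<close> is a unit normal to
  \<open>dir \<theta>\<close>, \<open>R\<close> is the image of an axis-parallel box under a
  rotation, whose determinant is 1.\<close>

lemma rotated_box:
  fixes a b c d \<theta> :: real
  assumes "a \<le> b" "c \<le> d"
  defines "R \<equiv> {x. a \<le> x \<bullet> dir \<theta> \<and> x \<bullet> dir \<theta> \<le> b \<and> c \<le> x \<bullet> dir (\<theta> + pi/2) \<and> x \<bullet> dir (\<theta> + pi/2) \<le> d}"
  shows "R \<in> lmeasurable" "measure lebesgue R = (b - a) * (d - c)"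
proof -
  define g where "g = (\<lambda>y::real^2. y$1 *\<^sub>R dir \<theta> + y$2 *\<^sub>R dir (\<theta> + pi/2))"
  let ?B = "cbox (vector [a, c]) (vector [b, d]) :: (real^2) set"
  have cs: "cos (\<theta> + pi/2) = - sin \<theta>" "sin (\<theta> + pi/2) = cos \<theta>"
    by (simp_all add: cos_add sin_add)
  have gR: "g y \<in> R \<longleftrightarrow> y \<in> ?B" for y
    by (simp add: R_def g_def inner_left_distrib inner_dir_dir mem_box_cart forall_2)
  have surj: "g (vector [x \<bullet> dir \<theta>, x \<bullet> dir (\<theta> + pi/2)]) = x" for x
    using sin_cos_squared_add[of \<theta>]
    by (simp add: g_def vec_eq_iff forall_2 inner_dir cs, intro conjI; algebra)
  have "R = g ` ?B"
  proof (intro equalityI subsetI)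
    fix x assume "x \<in> R"
    then show "x \<in> g ` ?B"
      using surj[of x] gR[of "vector [x \<bullet> dir \<theta>, x \<bullet> dir (\<theta> + pi/2)]"] by (metis imageI)
  qed (use gR in auto)
  moreover have "\<bar>dir \<theta> $ 1 * dir (\<theta> + pi/2) $ 2 - dir \<theta> $ 2 * dir (\<theta> + pi/2) $ 1\<bar> = 1"
    using sin_cos_squared_add2[of \<theta>] by (simp add: cs power2_eq_square)
  then have "g ` ?B \<in> lmeasurable" "measure lebesgue (g ` ?B) = (b - a) * (d - c)"
    unfolding g_def linear_combination_image_measure(2) measure_cbox_real2[OF assms(1,2)]
    by (simp_all only: linear_combination_image_measure(1) mult_1)
  ultimately show "R \<in> lmeasurable" "measure lebesgue R = (b - a) * (d - c)" by simp_all
qed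

section \<open>Support functions of planar sets\<close>

definition support_fun :: "(real^2) set \<Rightarrow> real \<Rightarrow> real" where
  "support_fun X \<theta> = (SUP x\<in>X. x \<bullet> dir \<theta>)"

lemma support_fun_upper:
  assumes "compact X" "x \<in> X"
  shows "x \<bullet> dir \<theta> \<le> support_fun X \<theta>"
proof -
  have "compact ((\<lambda>x. x \<bullet> dir \<theta>) ` X)"
    using assms(1) by (intro compact_continuous_image continuous_intros)
  then show ?thesis
    unfolding support_fun_def using assms(2)
    by (intro cSUP_upper bounded_imp_bdd_above compact_imp_bounded)
qed

lemma support_fun_attained:
  assumes "compact X" "X \<noteq> {}"
  obtains x where "x \<in> X" "x \<bullet> dir \<theta> = support_fun X \<theta>"
proof -
  have "continuous_on X (\<lambda>x. x \<bullet> dir \<theta>)" by (intro continuous_intros)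
  then obtain x where x: "x \<in> X" "\<And>y. y \<in> X \<Longrightarrow> y \<bullet> dir \<theta> \<le> x \<bullet> dir \<theta>"
    using continuous_attains_sup[OF assms] by blast
  then have "x \<bullet> dir \<theta> = support_fun X \<theta>"
    by (intro antisym support_fun_upper assms) (auto simp: support_fun_def assms intro: cSUP_least)
  with x show thesis using that by blast
qed

lemma support_fun_2pi: "support_fun X (\<theta> + 2 * pi) = support_fun X \<theta>"
  by (simp add: support_fun_def dir_2pi)

lemma continuous_on_dir [continuous_intros]:
  fixes f :: "'a::t2_space \<Rightarrow> real"
  assumes "continuous_on S f"
  shows "continuous_on S (\<lambda>x. dir (f x))"
proof -
  have "dir \<theta> = cos \<theta> *\<^sub>R axis 1 1 + sin \<theta> *\<^sub>R axis 2 1" for \<theta>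
    by (simp add: vec_eq_iff forall_2 axis_def)
  then have "(\<lambda>x. dir (f x)) = (\<lambda>x. cos (f x) *\<^sub>R axis 1 1 + sin (f x) *\<^sub>R axis 2 1)"
    by (rule ext)
  then show ?thesis using assms by (simp only:) (auto intro!: continuous_intros)
qed

text \<open>A maximizer for one angle competes at every other angle, so two values differ by at most
  \<open>B\<close> times the distance of the two unit vectors.\<close>

lemma continuous_on_support_fun:
  assumes "compact X" "X \<noteq> {}"
  shows "continuous_on S (support_fun X)"
proof -
  obtain B where B: "\<And>x. x \<in> X \<Longrightarrow> norm x \<le> B"
    using assms(1) compact_imp_bounded bounded_iff by metis
  have le: "support_fun X \<theta> - support_fun X \<phi> \<le> B * norm (dir \<theta> - dir \<phi>)" for \<theta> \<phi>
  proof -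
    obtain x where x: "x \<in> X" "x \<bullet> dir \<theta> = support_fun X \<theta>"
      using support_fun_attained[OF assms] .
    have "support_fun X \<theta> - support_fun X \<phi> \<le> x \<bullet> (dir \<theta> - dir \<phi>)"
      using support_fun_upper[OF assms(1) x(1), of \<phi>] x(2) by (simp add: inner_diff_right)
    also have "\<dots> \<le> norm x * norm (dir \<theta> - dir \<phi>)" by (rule norm_cauchy_schwarz)
    also have "\<dots> \<le> B * norm (dir \<theta> - dir \<phi>)" using B[OF x(1)] by (intro mult_right_mono) auto
    finally show ?thesis .
  qed
  have "continuous_on UNIV (support_fun X)"
  proof (rule continuous_at_imp_continuous_on, rule ballI)
    fix \<phi> :: real
    have "continuous_on UNIV (\<lambda>\<theta>. B * norm (dir \<theta> - dir \<phi>))" by (intro continuous_intros)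
    then have lim: "((\<lambda>\<theta>. B * norm (dir \<theta> - dir \<phi>)) \<longlongrightarrow> 0) (at \<phi>)"
      by (auto simp: continuous_on_eq_continuous_at isCont_def dest!: spec[of _ \<phi>])
    have "((\<lambda>\<theta>. support_fun X \<theta> - support_fun X \<phi>) \<longlongrightarrow> 0) (at \<phi>)"
    proof (rule Lim_null_comparison[OF _ lim], rule always_eventually, rule allI)
      show "norm (support_fun X \<theta> - support_fun X \<phi>) \<le> B * norm (dir \<theta> - dir \<phi>)" for \<theta>
        using le[of \<theta> \<phi>] le[of \<phi> \<theta>] norm_minus_commute[of "dir \<phi>" "dir \<theta>"]
        by (simp add: abs_le_iff)
    qed
    then show "isCont (support_fun X) \<phi>"
      by (simp add: isCont_def LIM_zero_iff)
  qed
  then show ?thesis by (rule continuous_on_subset) simp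
qed

section \<open>Area lost under a translation\<close>

text \<open>When \<open>X\<close> is convex, these are the starting points in \<open>X\<close> from
  which the needle with displacement \<open>v\<close> leaves \<open>X\<close>.\<close>

definition shift_loss :: "'a::real_vector set \<Rightarrow> 'a \<Rightarrow> 'a set" where
  "shift_loss X v = {x \<in> X. x + v \<notin> X}"

lemma lmeasurable_shift_loss:
  fixes X :: "'a::euclidean_space set"
  assumes "compact X"
  shows "shift_loss X v \<in> lmeasurable"
    and "measure lebesgue {x \<in> X. x + v \<in> X} = measure lebesgue X - measure lebesgue (shift_loss X v)"
proof -
  have "{x \<in> X. x + v \<in> X} = X \<inter> (\<lambda>x. x - v) ` X"
    by (auto simp: image_iff) (metis add_diff_cancel_right')
  moreover have "compact (X \<inter> (\<lambda>x. x - v) ` X)"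
    using assms by (intro compact_Int compact_continuous_image continuous_intros)
  ultimately have K: "{x \<in> X. x + v \<in> X} \<in> lmeasurable"
    using lmeasurable_compact by metis
  have X: "X \<in> lmeasurable" by (rule lmeasurable_compact[OF assms])
  have eq: "shift_loss X v = X - {x \<in> X. x + v \<in> X}" by (auto simp: shift_loss_def)
  show "shift_loss X v \<in> lmeasurable" unfolding eq using X K by (rule fmeasurable.Diff)
  show "measure lebesgue {x \<in> X. x + v \<in> X} = measure lebesgue X - measure lebesgue (shift_loss X v)"
    unfolding eq using X K by (subst measurable_measure_Diff) (auto simp: fmeasurableD)
qed

text \<open>The fixed term \<open>c\<close> is negligible after division by \<open>N\<close>. In
  both area estimates below it stands for the end effects in a comparison with \<open>N\<close>
  translates.\<close>

lemma linear_bound_by_multiples: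
  fixes a b c :: real
  assumes "\<And>N::nat. real N * a \<le> c + real N * b"
  shows "a \<le> b"
proof (rule ccontr)
  assume "\<not> a \<le> b"
  then obtain N :: nat where "real N * (a - b) > c"
    using reals_Archimedean3[of "a - b"] by auto
  then show False using assms[of N] by (simp add: algebra_simps)
qed

text \<open>The translates of the loss set by multiples of the shift are pairwise disjoint, so that
  many of them fit into a long rectangle.\<close>

lemma measure_shift_loss_le:
  fixes X :: "(real^2) set"
  assumes X: "compact X" "convex X" and l: "l > 0"
    and cd: "\<And>x. x \<in> X \<Longrightarrow> c \<le> x \<bullet> dir (\<theta> + pi/2) \<and> x \<bullet> dir (\<theta> + pi/2) \<le> d"
    and ne: "X \<noteq> {}"
  shows "measure lebesgue (shift_loss X (l *\<^sub>R dir \<theta>)) \<le> (d - c) * l"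
proof -
  define E where "E = shift_loss X (l *\<^sub>R dir \<theta>)"
  define F where "F j = (+) ((real j * l) *\<^sub>R dir \<theta>) ` E" for j :: nat
  have E: "E \<in> lmeasurable" unfolding E_def by (rule lmeasurable_shift_loss[OF X(1)])
  have F: "F j \<in> lmeasurable" "measure lebesgue (F j) = measure lebesgue E" for j
    unfolding F_def by (auto simp: E measurable_translation measure_translation)
  have F_iff: "x \<in> F j \<longleftrightarrow> x - (real j * l) *\<^sub>R dir \<theta> \<in> E" for x j
    unfolding F_def by (auto simp: image_iff) (metis add.commute diff_add_cancel)
  \<comment> \<open>A point common to two translates yields \<open>y\<close> in the loss set and a
    point of \<open>X\<close> lying \<open>(j - i) * l\<close> ahead of it. As \<open>j - i\<close>
    is at least 1, convexity puts \<open>y + l *\<^sub>R dir \<theta>\<close> into \<open>X\<close>,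
    so \<open>y\<close> is not lost after all.\<close>
  have disj_less: "F i \<inter> F j = {}" if "i < j" for i j
  proof (rule ccontr)
    assume "F i \<inter> F j \<noteq> {}"
    then obtain x where x: "x \<in> F i" "x \<in> F j" by auto
    define y where "y = x - (real j * l) *\<^sub>R dir \<theta>"
    have y: "y \<in> X" "y + l *\<^sub>R dir \<theta> \<notin> X"
      using x(2) by (auto simp: F_iff E_def shift_loss_def y_def)
    have z: "y + ((real j - real i) * l) *\<^sub>R dir \<theta> \<in> X"
      using x(1) by (auto simp: F_iff E_def shift_loss_def y_def algebra_simps)
    define t where "t = 1 / (real j - real i)"
    have t: "0 \<le> t" "t \<le> 1" "t * (real j - real i) = 1"
      using that by (auto simp: t_def)
    have "(1 - t) *\<^sub>R y + t *\<^sub>R (y + ((real j - real i) * l) *\<^sub>R dir \<theta>) \<in> X"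
      using convexD_alt[OF X(2) y(1) z t(1,2)] .
    also have "(1 - t) *\<^sub>R y + t *\<^sub>R (y + ((real j - real i) * l) *\<^sub>R dir \<theta>)
        = y + (t * (real j - real i) * l) *\<^sub>R dir \<theta>"
      by (simp add: algebra_simps)
    also have "\<dots> = y + l *\<^sub>R dir \<theta>" using t by simp
    finally show False using y by simp
  qed
  obtain B where B: "\<And>x. x \<in> X \<Longrightarrow> norm x \<le> B" "B > 0"
    using compact_imp_bounded[OF X(1)] bounded_pos by blast
  have cd_le: "c \<le> d" using cd ne by force
  have "real N * measure lebesgue E \<le> 2 * B * (d - c) + real N * ((d - c) * l)" for N
  proof -
    \<comment> \<open>Along \<open>dir \<theta>\<close> the set \<open>X\<close> fits between
      \<open>- B\<close> and \<open>B\<close>, and the translates with \<open>j < N\<close> move it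
      forward by at most \<open>N * l\<close>; the orthogonal coordinate does not change.\<close>
    let ?R = "{x. - B \<le> x \<bullet> dir \<theta> \<and> x \<bullet> dir \<theta> \<le> B + real N * l
        \<and> c \<le> x \<bullet> dir (\<theta> + pi/2) \<and> x \<bullet> dir (\<theta> + pi/2) \<le> d}"
    have R: "?R \<in> lmeasurable" "measure lebesgue ?R = (B + real N * l - - B) * (d - c)"
      using rotated_box[of "- B" "B + real N * l" c d \<theta>] B(2) l cd_le by auto
    have "real N * measure lebesgue E = (\<Sum>j<N. measure lebesgue (F j))"
      by (simp add: F)
    also have "\<dots> = measure lebesgue (\<Union>j<N. F j)"
    proof (rule measure_UNION'[symmetric])
      show "pairwise (\<lambda>i j. disjnt (F i) (F j)) {..<N}"
        unfolding pairwise_def disjnt_def using disj_less by (metis inf_commute linorder_neqE_nat)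
    qed (auto simp: F)
    also have "\<dots> \<le> measure lebesgue ?R"
    proof (rule measure_mono_fmeasurable[OF _ _ R(1)])
      show "(\<Union>j<N. F j) \<in> sets lebesgue" using F(1) by (auto simp: fmeasurableD)
      show "(\<Union>j<N. F j) \<subseteq> ?R"
      proof (rule UN_least, rule subsetI)
        fix j x assume j: "j \<in> {..<N}" and "x \<in> F j"
        define y where "y = x - (real j * l) *\<^sub>R dir \<theta>"
        have y: "y \<in> X" using \<open>x \<in> F j\<close> by (auto simp: F_iff E_def shift_loss_def y_def)
        have "\<bar>y \<bullet> dir \<theta>\<bar> \<le> B"
          using Cauchy_Schwarz_ineq2[of y "dir \<theta>"] B(1)[OF y] by simp
        moreover have "x \<bullet> dir \<theta> = y \<bullet> dir \<theta> + real j * l"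
            "x \<bullet> dir (\<theta> + pi/2) = y \<bullet> dir (\<theta> + pi/2)"
          by (simp_all add: y_def inner_diff_left inner_dir_dir)
        moreover have "real j * l \<le> real N * l" "0 \<le> real j * l" using j l by simp_all
        ultimately show "x \<in> ?R" using cd[OF y] by auto
      qed
    qed
    finally show ?thesis using R(2) by (simp add: algebra_simps)
  qed
  then show ?thesis using linear_bound_by_multiples unfolding E_def by blast
qed

text \<open>A long parallelogram is covered by \<open>X\<close> and translates of its loss set.\<close>

lemma measure_shift_loss_ge:
  fixes X :: "(real^2) set"
  assumes X: "compact X" "convex X" and l: "l > 0" "l < r" and ball: "cball p r \<subseteq> X"
  shows "(1 - l / r) * l * (support_fun X (\<theta> + pi/2) + support_fun X (\<theta> + pi/2 + pi))
      \<le> measure lebesgue (shift_loss X (l *\<^sub>R dir \<theta>))" (is "?a * l * ?w \<le> _")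
proof -
  define E where "E = shift_loss X (l *\<^sub>R dir \<theta>)"
  define F where "F j = (+) ((real j * l) *\<^sub>R dir \<theta>) ` E" for j :: nat
  define v where "v = dir (\<theta> + pi/2)"
  have r: "r > 0" using l by simp
  have a: "0 < ?a" "?a < 1" using l r by (simp_all add: field_simps)
  have E: "E \<in> lmeasurable" unfolding E_def by (rule lmeasurable_shift_loss[OF X(1)])
  have F: "F j \<in> lmeasurable" "measure lebesgue (F j) = measure lebesgue E" for j
    unfolding F_def by (auto simp: E measurable_translation measure_translation)
  have F_iff: "x \<in> F j \<longleftrightarrow> x - (real j * l) *\<^sub>R dir \<theta> \<in> E" for x j
    unfolding F_def by (auto simp: image_iff) (metis add.commute diff_add_cancel)
  have ne: "X \<noteq> {}" using ball r by auto
  \<comment> \<open>\<open>y2\<close> and \<open>y1\<close> support \<open>X\<close> in the two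
    directions orthogonal to \<open>dir \<theta>\<close>, so that \<open>?w\<close> is the width of
    \<open>X\<close> across the needle.\<close>
  obtain y2 where y2: "y2 \<in> X" "y2 \<bullet> v = support_fun X (\<theta> + pi/2)"
    using support_fun_attained[OF X(1) ne] unfolding v_def .
  obtain y1 where y1: "y1 \<in> X" "y1 \<bullet> dir (\<theta> + pi/2 + pi) = support_fun X (\<theta> + pi/2 + pi)"
    using support_fun_attained[OF X(1) ne] .
  have w: "(y2 - y1) \<bullet> v = ?w"
    unfolding y1(2)[unfolded dir_pi, symmetric] y2(2)[symmetric] by (simp add: inner_diff_left v_def)
  have w0: "0 \<le> ?w"
    using support_fun_upper[OF X(1) y1(1), of "\<theta> + pi/2"]
    unfolding y1(2)[unfolded dir_pi, symmetric] by simp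
  have "real N * (?a * l * ?w) \<le> measure lebesgue X + real N * measure lebesgue E" for N
  proof -
    \<comment> \<open>One side of \<open>Q\<close> is the chord from \<open>y1\<close> to
      \<open>y2\<close> contracted towards \<open>p\<close> by the factor \<open>1 - l / r\<close>;
      the other has length \<open>N * l\<close> along \<open>dir \<theta>\<close>. The contraction
      leaves room to move each point of the chord forward by up to \<open>l\<close> within
      \<open>X\<close>.\<close>
    define b where "b = ?a *\<^sub>R (y2 - y1)"
    define Q where "Q = (+) (p + ?a *\<^sub>R (y1 - p)) `
        (\<lambda>y::real^2. y$1 *\<^sub>R b + y$2 *\<^sub>R dir \<theta>) ` cbox (vector [0, 0]) (vector [1, real N * l])"
    have Q: "Q \<in> lmeasurable"
      unfolding Q_def by (intro measurable_translation linear_combination_image_measure)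
    have "b$1 * sin \<theta> - b$2 * cos \<theta> = - (b \<bullet> v)"
      by (simp add: v_def inner_dir cos_add sin_add)
    also have "\<dots> = - (?a * ?w)" by (simp add: b_def w)
    finally have "\<bar>b$1 * sin \<theta> - b$2 * cos \<theta>\<bar> = ?a * ?w" using a w0 by simp
    then have "measure lebesgue Q = ?a * ?w * (real N * l)"
      unfolding Q_def using l measure_cbox_real2[of 0 1 0 "real N * l"]
      by (simp add: measure_translation linear_combination_image_measure)
    moreover have "Q \<subseteq> X \<union> (\<Union>j\<in>{1..N}. F j)"
    proof
      fix x assume "x \<in> Q"
      then obtain z :: "real^2" where z: "z \<in> cbox (vector [0, 0]) (vector [1, real N * l])"
        and x: "x = p + ?a *\<^sub>R (y1 - p) + (z$1 *\<^sub>R b + z$2 *\<^sub>R dir \<theta>)"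
        unfolding Q_def by auto
      have z: "0 \<le> z$1" "z$1 \<le> 1" "0 \<le> z$2" "z$2 \<le> real N * l"
        using z by (auto simp: mem_box_cart forall_2)
      define y where "y = (1 - z$1) *\<^sub>R y1 + z$1 *\<^sub>R y2"
      have y: "y \<in> X" unfolding y_def using convexD_alt[OF X(2) y1(1) y2(1)] z by simp
      define j where "j = nat \<lfloor>z$2 / l\<rfloor>"
      have jl: "real j \<le> z$2 / l" "z$2 / l < real j + 1"
        using z l unfolding j_def by (simp_all add: of_nat_nat)
      have "z$2 / l \<le> real N" using z l by (simp add: field_simps)
      with jl have jN: "j \<le> N" by linarith
      define s where "s = z$2 - real j * l"
      have s: "0 \<le> s" "s \<le> l" using jl l by (simp_all add: s_def field_simps)
      \<comment> \<open>The point at distance \<open>s * r / l\<close> from \<open>p\<close> stays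
        in the ball because \<open>s \<le> l\<close>. Mixing it in with weight \<open>l / r\<close>
        moves the contracted chord point forward by exactly \<open>s\<close>, still inside
        \<open>X\<close>.\<close>
      have "norm ((s * r / l) *\<^sub>R dir \<theta>) \<le> r"
        using s l r by (simp add: field_simps)
      then have "p + (s * r / l) *\<^sub>R dir \<theta> \<in> X"
        using ball by (auto simp: dist_norm)
      then have "(1 - l / r) *\<^sub>R y + (l / r) *\<^sub>R (p + (s * r / l) *\<^sub>R dir \<theta>) \<in> X"
        using convexD_alt[OF X(2) y] a l r by simp
      also have "(1 - l / r) *\<^sub>R y + (l / r) *\<^sub>R (p + (s * r / l) *\<^sub>R dir \<theta>)
          = p + ?a *\<^sub>R (y - p) + s *\<^sub>R dir \<theta>"
        using l r by (simp add: algebra_simps)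
      also have "\<dots> = x - (real j * l) *\<^sub>R dir \<theta>"
        unfolding x y_def b_def s_def by (simp add: algebra_simps)
      finally have j: "x - (real j * l) *\<^sub>R dir \<theta> \<in> X" .
      \<comment> \<open>Going back from \<open>x\<close> in steps of \<open>l\<close>, the first
        point in \<open>X\<close> is reached after \<open>i\<close> steps. If \<open>i > 0\<close>,
        one step forward from that point leaves \<open>X\<close>, so it is in the loss set and
        \<open>x\<close> belongs to \<open>F i\<close>.\<close>
      define i where "i = (LEAST i. x - (real i * l) *\<^sub>R dir \<theta> \<in> X)"
      have i: "x - (real i * l) *\<^sub>R dir \<theta> \<in> X" "i \<le> N"
        "\<And>k. k < i \<Longrightarrow> x - (real k * l) *\<^sub>R dir \<theta> \<notin> X"
        using LeastI[of "\<lambda>i. x - (real i * l) *\<^sub>R dir \<theta> \<in> X", OF j]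
          Least_le[of "\<lambda>i. x - (real i * l) *\<^sub>R dir \<theta> \<in> X", OF j] jN
          not_less_Least[of _ "\<lambda>i. x - (real i * l) *\<^sub>R dir \<theta> \<in> X"]
        unfolding i_def by auto
      show "x \<in> X \<union> (\<Union>j\<in>{1..N}. F j)"
      proof (cases i)
        case 0
        then show ?thesis using i(1) by simp
      next
        case (Suc k)
        have "x - (real i * l) *\<^sub>R dir \<theta> + l *\<^sub>R dir \<theta> = x - (real k * l) *\<^sub>R dir \<theta>"
          unfolding Suc by (simp add: algebra_simps)
        then have "x \<in> F i" using i(1) i(3)[of k] Suc unfolding F_iff E_def shift_loss_def by (metis (mono_tags, lifting) lessI mem_Collect_eq)
        then show ?thesis using i(2) Suc by auto
      qed
    qed
    moreover have XF: "X \<union> (\<Union>j\<in>{1..N}. F j) \<in> lmeasurable"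
      using F(1) lmeasurable_compact[OF X(1)] by (intro fmeasurable.Un fmeasurable.finite_UN) auto
    ultimately have "?a * ?w * (real N * l) \<le> measure lebesgue (X \<union> (\<Union>j\<in>{1..N}. F j))"
      using measure_mono_fmeasurable[of Q _ lebesgue] Q by (metis fmeasurableD)
    also have "\<dots> \<le> measure lebesgue X + measure lebesgue (\<Union>j\<in>{1..N}. F j)"
      using F(1) lmeasurable_compact[OF X(1)] by (intro measure_Un_le) (auto simp: fmeasurableD)
    also have "measure lebesgue (\<Union>j\<in>{1..N}. F j) \<le> (\<Sum>j\<in>{1..N}. measure lebesgue (F j))"
      using F(1) by (intro measure_UNION_le) (auto simp: fmeasurableD)
    finally show ?thesis by (simp add: F algebra_simps)
  qed
  then show ?thesis using linear_bound_by_multiples unfolding E_def by blast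
qed

section \<open>The isoperimetric inequality for the mean width\<close>

lemma dir_add_2pi_int: "dir (\<theta> + 2 * pi * of_int j) = dir \<theta>"
  by (simp add: vec_eq_iff forall_2 cos_add sin_add)

text \<open>A point supporting \<open>X\<close> at \<open>\<theta>\<close> competes at both
  neighbouring angles, and the two neighbouring unit vectors add up to
  \<open>2 * cos \<delta>\<close> times \<open>dir \<theta>\<close>. For the circumscribed polygon
  this says that side lengths are nonnegative.\<close>

lemma support_fun_neighbours:
  assumes "compact X" "X \<noteq> {}"
  shows "2 * cos \<delta> * support_fun X \<theta> \<le> support_fun X (\<theta> + \<delta>) + support_fun X (\<theta> - \<delta>)"
proof -
  obtain y where y: "y \<in> X" "y \<bullet> dir \<theta> = support_fun X \<theta>"
    using support_fun_attained[OF assms] .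
  have "y \<bullet> dir (\<theta> + \<delta>) + y \<bullet> dir (\<theta> - \<delta>) = 2 * cos \<delta> * (y \<bullet> dir \<theta>)"
    by (simp add: inner_dir cos_add sin_add cos_diff sin_diff algebra_simps)
  with y support_fun_upper[OF assms(1) y(1), of "\<theta> + \<delta>"] support_fun_upper[OF assms(1) y(1), of "\<theta> - \<delta>"]
  show ?thesis by simp
qed

text \<open>\<open>P\<close> is the circumscribed polygon with normals \<open>dir (k\<delta>)\<close>. The layer between \<open>P\<close> and
  \<open>(1 + \<epsilon>) P\<close> is covered by one thin rectangle per side; comparing areas to first order in \<open>\<epsilon>\<close>
  bounds the area of \<open>P\<close>.\<close>

lemma measure_le_circumscribed:
  fixes m :: nat
  assumes X: "compact X" "0 \<in> X" and m: "m \<ge> 1"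
  defines "n \<equiv> 4 * m"
  defines "\<delta> \<equiv> 2 * pi / real n"
  defines "h \<equiv> support_fun X"
  shows "measure lebesgue X \<le> (\<Sum>k<n. h (real k * \<delta>) * h (real (Suc k) * \<delta>) - cos \<delta> * (h (real k * \<delta>))\<^sup>2) / sin \<delta>"
proof -
  have ne: "X \<noteq> {}" using X by auto
  have n: "n > 0" "real n * \<delta> = 2 * pi" using m by (simp_all add: n_def \<delta>_def)
  \<comment> \<open>As \<open>n\<close> is a multiple of four, the normals include the four axis
    directions, which makes \<open>P\<close> bounded; also \<open>\<delta> \<le> pi / 2\<close>,
    which keeps \<open>cos \<delta>\<close> nonnegative.\<close>
  have md: "real m * \<delta> = pi / 2" using m by (simp add: n_def \<delta>_def)
  have \<delta>: "0 < \<delta>" "\<delta> \<le> pi / 2"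
    using m by (simp_all add: n_def \<delta>_def field_simps)
  have sd: "sin \<delta> > 0" using \<delta> pi_gt_zero by (intro sin_gt_zero) linarith+
  have cd: "cos \<delta> \<ge> 0" using \<delta> by (intro cos_ge_zero) linarith+
  \<comment> \<open>The origin lies in \<open>X\<close>, so \<open>h\<close> is nonnegative; hence
    \<open>P\<close> is star-shaped about the origin and contained in its dilates.\<close>
  have h0: "h \<theta> \<ge> 0" for \<theta>
    using support_fun_upper[OF X, of \<theta>] by (simp add: h_def)
  have hper: "h (\<theta> + 2 * pi) = h \<theta>" for \<theta> unfolding h_def by (rule support_fun_2pi)
  define P where "P = {x. \<forall>k::int. x \<bullet> dir (of_int k * \<delta>) \<le> h (of_int k * \<delta>)}"
  have "P = (\<Inter>k::int. {x. dir (of_int k * \<delta>) \<bullet> x \<le> h (of_int k * \<delta>)})"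
    by (auto simp: P_def inner_commute)
  then have clP: "closed P"
    by (simp only:) (intro closed_INT ballI closed_halfspace_le)
  have "bounded P"
  proof (rule bounded_subset[OF bounded_cbox])
    show "P \<subseteq> cbox (vector [- h pi, - h (3 * pi / 2)]) (vector [h 0, h (pi / 2)])"
    proof
      fix x assume x: "x \<in> P"
      have xk: "x \<bullet> dir (of_int k * \<delta>) \<le> h (of_int k * \<delta>)" for k
        using x by (simp add: P_def)
      have "of_int (int m) * \<delta> = pi / 2" "of_int (2 * int m) * \<delta> = pi" "of_int (3 * int m) * \<delta> = 3 * pi / 2"
        using md by (simp_all add: algebra_simps)
      then have "x \<bullet> dir 0 \<le> h 0" "x \<bullet> dir (pi/2) \<le> h (pi/2)" "x \<bullet> dir pi \<le> h pi" "x \<bullet> dir (3*pi/2) \<le> h (3*pi/2)"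
        using xk[of 0] xk[of "int m"] xk[of "2 * int m"] xk[of "3 * int m"] by (simp_all only: of_int_0 mult_zero_left)
      then show "x \<in> cbox (vector [- h pi, - h (3 * pi / 2)]) (vector [h 0, h (pi / 2)])"
        using cos_3over2_pi sin_3over2_pi by (simp add: mem_box_cart forall_2 inner_dir)
    qed
  qed
  with clP have P: "P \<in> lmeasurable" by (simp add: lmeasurable_compact compact_eq_bounded_closed)
  have "X \<subseteq> P" using support_fun_upper[OF X(1)] by (auto simp: P_def h_def)
  then have XP: "measure lebesgue X \<le> measure lebesgue P"
    using P lmeasurable_compact[OF X(1)] by (intro measure_mono_fmeasurable) (auto simp: fmeasurableD)
  have Pconv: "t *\<^sub>R x \<in> P" if "x \<in> P" "0 \<le> t" "t \<le> 1" for t x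
    unfolding P_def
  proof (intro CollectI allI)
    fix k :: int
    have "x \<bullet> dir (of_int k * \<delta>) \<le> h (of_int k * \<delta>)" using that by (simp add: P_def)
    then have "t * (x \<bullet> dir (of_int k * \<delta>)) \<le> t * h (of_int k * \<delta>)"
      using that by (intro mult_left_mono) auto
    also have "\<dots> \<le> 1 * h (of_int k * \<delta>)"
      using that h0 by (intro mult_right_mono) auto
    finally show "t *\<^sub>R x \<bullet> dir (of_int k * \<delta>) \<le> h (of_int k * \<delta>)" by simp
  qed
  \<comment> \<open>In \<open>S\<close> each value of \<open>h\<close> multiplies the length of the
    corresponding side of the polygon, the classical formula for twice the area. \<open>T\<close> is
    the coefficient of the second-order error of the rectangle cover.\<close>
  define S where "S = (\<Sum>k<n. h (real k * \<delta>) * (h (real k * \<delta> + \<delta>) + h (real k * \<delta> - \<delta>) - 2 * cos \<delta> * h (real k * \<delta>)) / sin \<delta>)"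
  define T where "T = (\<Sum>k<n. h (real k * \<delta>) * (h (real k * \<delta> + \<delta>) + h (real k * \<delta> - \<delta>)) / sin \<delta>)"
  have main: "2 * measure lebesgue P \<le> S + \<epsilon> * T" if \<epsilon>: "\<epsilon> > 0" for \<epsilon>
  proof -
    define Q where "Q = (\<lambda>x. (1 + \<epsilon>) *\<^sub>R x) ` P"
    have Q: "Q \<in> lmeasurable" "measure lebesgue Q = (1 + \<epsilon>)\<^sup>2 * measure lebesgue P"
      using measure_lebesgue_affine[of "1 + \<epsilon>" 0 P] measurable_linear_image[of "\<lambda>x. (1 + \<epsilon>) *\<^sub>R x" P] P \<epsilon>
      by (simp_all add: Q_def)
    have PQ: "P \<subseteq> Q"
    proof
      fix x assume "x \<in> P"
      then have "inverse (1 + \<epsilon>) *\<^sub>R x \<in> P" using \<epsilon> by (intro Pconv) (auto simp: field_simps)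
      then have "(1 + \<epsilon>) *\<^sub>R inverse (1 + \<epsilon>) *\<^sub>R x \<in> Q" unfolding Q_def by (rule imageI)
      then show "x \<in> Q" using \<epsilon> by simp
    qed
    \<comment> \<open>A point of \<open>Q\<close> beyond the \<open>k\<close>-th side also satisfies
      the dilated constraints at the two neighbouring angles. Written in the orthonormal frame of
      the \<open>k\<close>-th normal, these bound the tangential coordinate by \<open>lo k\<close>
      and \<open>hi k\<close>.\<close>
    define lo where "lo k = - (((1 + \<epsilon>) * h (real k * \<delta> - \<delta>) - h (real k * \<delta>) * cos \<delta>) / sin \<delta>)" for k :: nat
    define hi where "hi k = ((1 + \<epsilon>) * h (real k * \<delta> + \<delta>) - h (real k * \<delta>) * cos \<delta>) / sin \<delta>" for k :: nat
    define R where "R k = {x. h (real k * \<delta>) \<le> x \<bullet> dir (real k * \<delta>) \<and> x \<bullet> dir (real k * \<delta>) \<le> (1 + \<epsilon>) * h (real k * \<delta>)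
        \<and> lo k \<le> x \<bullet> dir (real k * \<delta> + pi/2) \<and> x \<bullet> dir (real k * \<delta> + pi/2) \<le> hi k}" for k :: nat
    have diff: "hi k - lo k = ((1 + \<epsilon>) * (h (real k * \<delta> + \<delta>) + h (real k * \<delta> - \<delta>)) - 2 * cos \<delta> * h (real k * \<delta>)) / sin \<delta>" for k
      by (simp add: hi_def lo_def diff_divide_distrib add_divide_distrib algebra_simps)
    have "2 * cos \<delta> * h (real k * \<delta>) \<le> (1 + \<epsilon>) * (h (real k * \<delta> + \<delta>) + h (real k * \<delta> - \<delta>))" for k
    proof -
      have "2 * cos \<delta> * h (real k * \<delta>) \<le> h (real k * \<delta> + \<delta>) + h (real k * \<delta> - \<delta>)"
        unfolding h_def by (rule support_fun_neighbours[OF X(1) ne])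
      also have "\<dots> \<le> (1 + \<epsilon>) * (h (real k * \<delta> + \<delta>) + h (real k * \<delta> - \<delta>))"
        using \<epsilon> h0[of "real k * \<delta> + \<delta>"] h0[of "real k * \<delta> - \<delta>"] by (simp add: algebra_simps)
      finally show ?thesis .
    qed
    then have "0 \<le> hi k - lo k" for k unfolding diff using sd by simp
    then have lohi: "lo k \<le> hi k" for k by (metis diff_ge_0_iff_ge)
    have hh: "h (real k * \<delta>) \<le> (1 + \<epsilon>) * h (real k * \<delta>)" for k
      using \<epsilon> h0 by (simp add: algebra_simps)
    have R: "R k \<in> lmeasurable" "measure lebesgue (R k) = ((1 + \<epsilon>) * h (real k * \<delta>) - h (real k * \<delta>)) * (hi k - lo k)" for k
      unfolding R_def using rotated_box[OF hh lohi] by auto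
    have cover: "Q - P \<subseteq> (\<Union>k<n. R k)"
    proof
      fix x assume x: "x \<in> Q - P"
      then obtain y where y: "y \<in> P" "x = (1 + \<epsilon>) *\<^sub>R y" by (auto simp: Q_def)
      have up: "x \<bullet> dir (of_int k * \<delta>) \<le> (1 + \<epsilon>) * h (of_int k * \<delta>)" for k
        using y \<epsilon> by (auto simp: P_def)
      obtain k0 where k0: "x \<bullet> dir (of_int k0 * \<delta>) > h (of_int k0 * \<delta>)"
        using x by (auto simp: P_def not_le)
      define k where "k = nat (k0 mod int n)"
      have k: "k < n" using n by (simp add: k_def nat_less_iff)
      have "of_int k0 * \<delta> = real k * \<delta> + 2 * pi * of_int (k0 div int n)"
      proof -
        have "k0 = int k + int n * (k0 div int n)" using n by (simp add: k_def)
        then have "(of_int k0 :: real) = real k + real n * of_int (k0 div int n)"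
          by (metis of_int_add of_int_mult of_int_of_nat_eq)
        then have "of_int k0 * \<delta> = real k * \<delta> + (real n * \<delta>) * of_int (k0 div int n)"
          by (simp add: algebra_simps)
        then show ?thesis using n by simp
      qed
      then have "dir (of_int k0 * \<delta>) = dir (real k * \<delta>)" by (simp only: dir_add_2pi_int)
      then have low: "x \<bullet> dir (real k * \<delta>) > h (real k * \<delta>)"
        using k0 by (simp add: h_def support_fun_def)
      let ?\<theta> = "real k * \<delta>"
      have ups: "x \<bullet> dir ?\<theta> \<le> (1 + \<epsilon>) * h ?\<theta>" "x \<bullet> dir (?\<theta> + \<delta>) \<le> (1 + \<epsilon>) * h (?\<theta> + \<delta>)"
        "x \<bullet> dir (?\<theta> - \<delta>) \<le> (1 + \<epsilon>) * h (?\<theta> - \<delta>)"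
        using up[of "int k"] up[of "int k + 1"] up[of "int k - 1"] by (simp_all add: algebra_simps)
      have rot: "x \<bullet> dir (?\<theta> + \<delta>) = (x \<bullet> dir ?\<theta>) * cos \<delta> + (x \<bullet> dir (?\<theta> + pi/2)) * sin \<delta>"
        "x \<bullet> dir (?\<theta> - \<delta>) = (x \<bullet> dir ?\<theta>) * cos \<delta> - (x \<bullet> dir (?\<theta> + pi/2)) * sin \<delta>"
        by (simp_all add: inner_dir cos_add sin_add cos_diff sin_diff algebra_simps)
      have lc: "h ?\<theta> * cos \<delta> \<le> (x \<bullet> dir ?\<theta>) * cos \<delta>"
        using low cd by (intro mult_right_mono) auto
      have "(x \<bullet> dir (?\<theta> + pi/2)) * sin \<delta> \<le> (1 + \<epsilon>) * h (?\<theta> + \<delta>) - h ?\<theta> * cos \<delta>"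
        "- (x \<bullet> dir (?\<theta> + pi/2)) * sin \<delta> \<le> (1 + \<epsilon>) * h (?\<theta> - \<delta>) - h ?\<theta> * cos \<delta>"
        using ups(2,3) lc unfolding rot by linarith+
      then have "x \<bullet> dir (?\<theta> + pi/2) \<le> hi k" "- (x \<bullet> dir (?\<theta> + pi/2)) \<le> - lo k"
        unfolding hi_def lo_def minus_minus pos_le_divide_eq[OF sd] by simp_all
      then have "x \<in> R k" using low ups(1) by (simp add: R_def)
      then show "x \<in> (\<Union>k<n. R k)" using k by blast
    qed
    \<comment> \<open>The layer has area \<open>\<epsilon> * (2 + \<epsilon>)\<close> times that of
      \<open>P\<close>; one factor \<open>\<epsilon>\<close> cancels against the thickness of the
      rectangles.\<close>
    have "(1 + \<epsilon>)\<^sup>2 * measure lebesgue P - measure lebesgue P = measure lebesgue (Q - P)"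
      using P Q PQ by (simp add: measurable_measure_Diff fmeasurableD)
    also have "\<dots> \<le> measure lebesgue (\<Union>k<n. R k)"
      using P Q R cover by (intro measure_mono_fmeasurable) (auto simp: fmeasurableD intro!: fmeasurable.finite_UN)
    also have "\<dots> \<le> (\<Sum>k<n. measure lebesgue (R k))"
      using R by (intro measure_UNION_le) (auto simp: fmeasurableD)
    also have "\<dots> = \<epsilon> * (S + \<epsilon> * T)"
      unfolding S_def T_def sum_distrib_left sum.distrib[symmetric] R(2) diff
      using sd by (intro sum.cong refl) (simp add: field_simps)
    finally have "\<epsilon> * ((2 + \<epsilon>) * measure lebesgue P) \<le> \<epsilon> * (S + \<epsilon> * T)"
      by (simp add: power2_eq_square algebra_simps)
    then have "(2 + \<epsilon>) * measure lebesgue P \<le> S + \<epsilon> * T"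
      using \<epsilon> by (simp only: mult_le_cancel_left_pos)
    moreover have "\<epsilon> * measure lebesgue P \<ge> 0" using \<epsilon> by simp
    ultimately show ?thesis by (simp add: algebra_simps)
  qed
  have "2 * measure lebesgue P \<le> S"
  proof (rule tendsto_lowerbound)
    show "((\<lambda>\<epsilon>. S + \<epsilon> * T) \<longlongrightarrow> S) (at_right 0)"
      by (rule tendsto_eq_intros refl | simp)+
    show "\<forall>\<^sub>F \<epsilon> in at_right 0. 2 * measure lebesgue P \<le> S + \<epsilon> * T"
      using main eventually_at_right_less[of 0] by (auto elim!: eventually_mono)
  qed simp
  also have "S = 2 * ((\<Sum>k<n. h (real k * \<delta>) * h (real (Suc k) * \<delta>) - cos \<delta> * (h (real k * \<delta>))\<^sup>2) / sin \<delta>)"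
  proof -
    \<comment> \<open>\<open>S\<close> contains each product of neighbouring values twice, once from
      either side; periodicity of \<open>h\<close> allows the index to be shifted by one.\<close>
    define g where "g k = h (real k * \<delta>) * h (real k * \<delta> - \<delta>)" for k
    have gS: "g (Suc k) = h (real k * \<delta>) * h (real (Suc k) * \<delta>)" for k
      by (simp add: g_def algebra_simps)
    have "g n = g 0"
      unfolding g_def n(2) using hper[of 0] hper[of "-\<delta>"] by (simp add: algebra_simps)
    then have "(\<Sum>k<n. g (Suc k)) = (\<Sum>k<n. g k)"
      using sum_lessThan_telescope[of g n] by (simp add: sum_subtractf)
    moreover have "S * sin \<delta> = (\<Sum>k<n. g (Suc k) + g k - 2 * (cos \<delta> * (h (real k * \<delta>))\<^sup>2))"
      unfolding S_def sum_distrib_right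
    proof (intro sum.cong refl)
      fix k
      have "h (real k * \<delta> + \<delta>) = h (real (Suc k) * \<delta>)" by (simp add: algebra_simps)
      then show "h (real k * \<delta>) * (h (real k * \<delta> + \<delta>) + h (real k * \<delta> - \<delta>) - 2 * cos \<delta> * h (real k * \<delta>)) / sin \<delta> * sin \<delta>
          = g (Suc k) + g k - 2 * (cos \<delta> * (h (real k * \<delta>))\<^sup>2)"
        unfolding gS g_def[of k] using sd by (simp add: right_diff_distrib distrib_left power2_eq_square)
    qed
    ultimately have "S * sin \<delta> = 2 * (\<Sum>k<n. g (Suc k) - cos \<delta> * (h (real k * \<delta>))\<^sup>2)"
      by (simp add: sum.distrib sum_subtractf sum_distrib_left)
    then show ?thesis unfolding gS using sd by (simp add: field_simps)
  qed
  finally show ?thesis using XP by simp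
qed

section \<open>Discrete Fourier analysis on equally spaced angles\<close>

lemma sum_cos_multiples:
  fixes n :: nat and s :: int
  assumes "n > 0"
  defines "\<delta> \<equiv> 2 * pi / real n"
  shows "(\<Sum>m<n. cos (real m * (of_int s * \<delta>))) = (if int n dvd s then real n else 0)"
proof -
  \<comment> \<open>The sum is the real part of a geometric series in the \<open>n\<close>-th root
    of unity \<open>z\<close>, and \<open>z = 1\<close> exactly when \<open>n\<close> divides
    \<open>s\<close>.\<close>
  define z where "z = cis (of_int s * \<delta>)"
  have zn: "z ^ n = 1"
  proof -
    have "z ^ n = cis (2 * pi * of_int s)"
      unfolding z_def Complex.DeMoivre using assms(1) by (simp add: \<delta>_def mult_ac)
    also have "\<dots> = 1" by (rule cis_multiple_2pi) simp
    finally show ?thesis .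
  qed
  have "(\<Sum>m<n. cos (real m * (of_int s * \<delta>))) = Re (\<Sum>m<n. z ^ m)"
    by (simp add: z_def Complex.DeMoivre)
  also have "\<dots> = (if int n dvd s then real n else 0)"
  proof (cases "int n dvd s")
    case True
    then obtain k where "s = int n * k" by auto
    then have "z = cis (2 * pi * of_int k)"
      unfolding z_def \<delta>_def using assms(1) by (simp add: field_simps)
    also have "\<dots> = 1" by (rule cis_multiple_2pi) simp
    finally show ?thesis using True by simp
  next
    case False
    have "z \<noteq> 1"
    proof
      assume "z = 1"
      then have "cos (of_int s * \<delta>) = 1" by (simp add: z_def complex_eq_iff)
      then obtain k :: int where "of_int s * \<delta> = of_int k * 2 * pi"
        using cos_one_2pi_int by auto
      then have "of_int s = (of_int (k * int n) :: real)"
        using assms(1) by (simp add: \<delta>_def field_simps)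
      then have "s = k * int n" by (simp only: of_int_eq_iff)
      then show False using False by simp
    qed
    then have "(\<Sum>m<n. z ^ m) = 0" using zn by (simp add: geometric_sum)
    then show ?thesis using False by simp
  qed
  finally show ?thesis .
qed

definition dft_cos :: "nat \<Rightarrow> (nat \<Rightarrow> real) \<Rightarrow> nat \<Rightarrow> real" where
  "dft_cos n f m = (\<Sum>k<n. f k * cos (real m * (real k * (2 * pi / real n))))"

definition dft_sin :: "nat \<Rightarrow> (nat \<Rightarrow> real) \<Rightarrow> nat \<Rightarrow> real" where
  "dft_sin n f m = (\<Sum>k<n. f k * sin (real m * (real k * (2 * pi / real n))))"

text \<open>The squared modulus of the \<open>m\<close>-th discrete Fourier coefficient of the real
  sequence \<open>f\<close>, kept in real form through its cosine and sine parts.\<close>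

definition dft_energy :: "nat \<Rightarrow> (nat \<Rightarrow> real) \<Rightarrow> nat \<Rightarrow> real" where
  "dft_energy n f m = (dft_cos n f m)\<^sup>2 + (dft_sin n f m)\<^sup>2"

lemma dft_energy_eq:
  "dft_energy n f m = (\<Sum>j<n. \<Sum>k<n. f j * f k * cos (real m * (of_int (int j - int k) * (2 * pi / real n))))"
proof -
  have "dft_energy n f m = (\<Sum>j<n. \<Sum>k<n.
      f j * cos (real m * (real j * (2 * pi / real n))) * (f k * cos (real m * (real k * (2 * pi / real n))))
    + f j * sin (real m * (real j * (2 * pi / real n))) * (f k * sin (real m * (real k * (2 * pi / real n)))))"
    by (simp add: dft_energy_def dft_cos_def dft_sin_def power2_eq_square sum_product sum.distrib)
  also have "\<dots> = (\<Sum>j<n. \<Sum>k<n. f j * f k * cos (real m * (of_int (int j - int k) * (2 * pi / real n))))"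
  proof (intro sum.cong refl)
    fix j k
    let ?d = "2 * pi / real n"
    have "real m * (of_int (int j - int k) * d) = real m * (real j * d) - real m * (real k * d)" for d
      by (simp add: algebra_simps)
    then have "cos (real m * (of_int (int j - int k) * ?d)) = cos (real m * (real j * ?d) - real m * (real k * ?d))"
      by (simp only:)
    then show "f j * cos (real m * (real j * ?d)) * (f k * cos (real m * (real k * ?d)))
        + f j * sin (real m * (real j * ?d)) * (f k * sin (real m * (real k * ?d)))
        = f j * f k * cos (real m * (of_int (int j - int k) * ?d))"
      unfolding cos_diff by (simp only:) (simp add: algebra_simps del: times_divide_eq_right)
  qed
  finally show ?thesis .
qed

text \<open>The energy is a double sum of cosines at the index differences \<open>j - k\<close>. The
  product formula turns the extra cosine into shifts by \<open>s\<close> and \<open>- s\<close>, and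
  summing over \<open>m\<close> keeps only the pairs whose difference is congruent to one of the
  shifts modulo \<open>n\<close>. The cases \<open>s = 0\<close> and \<open>s = 1\<close> give
  Parseval's identity and the correlation of neighbours.\<close>

lemma dft_energy_correlation:
  fixes n :: nat and f :: "nat \<Rightarrow> real" and s :: int
  assumes n: "n > 0"
  shows "(\<Sum>m<n. dft_energy n f m * cos (real m * (of_int s * (2 * pi / real n))))
       = real n / 2 * (\<Sum>j<n. \<Sum>k<n. f j * f k *
           ((if int n dvd int j - int k + s then 1 else 0) + (if int n dvd int j - int k - s then 1 else 0)))"
proof -
  let ?d = "2 * pi / real n"
  have "(\<Sum>m<n. dft_energy n f m * cos (real m * (of_int s * ?d)))
      = (\<Sum>m<n. \<Sum>j<n. \<Sum>k<n. f j * f k / 2 * (cos (real m * (of_int (int j - int k + s) * ?d))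
          + cos (real m * (of_int (int j - int k - s) * ?d))))"
    unfolding dft_energy_eq sum_distrib_right
  proof (intro sum.cong refl)
    fix m j k
    let ?a = "real m * (of_int (int j - int k) * ?d)" and ?b = "real m * (of_int s * ?d)"
    have "real m * (of_int (int j - int k + s) * d) = real m * (of_int (int j - int k) * d) + real m * (of_int s * d)"
      "real m * (of_int (int j - int k - s) * d) = real m * (of_int (int j - int k) * d) - real m * (of_int s * d)" for d
      by (simp_all add: algebra_simps)
    from this[of ?d] show "f j * f k * cos ?a * cos ?b = f j * f k / 2 * (cos (real m * (of_int (int j - int k + s) * ?d))
          + cos (real m * (of_int (int j - int k - s) * ?d)))"
      by (simp only: cos_add cos_diff) simp
  qed
  also have "\<dots> = (\<Sum>j<n. \<Sum>k<n. \<Sum>m<n. f j * f k / 2 * (cos (real m * (of_int (int j - int k + s) * ?d))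
          + cos (real m * (of_int (int j - int k - s) * ?d))))"
    by (subst sum.swap, rule sum.cong[OF refl], subst sum.swap, rule refl)
  also have "\<dots> = (\<Sum>j<n. \<Sum>k<n. f j * f k / 2 *
       ((if int n dvd int j - int k + s then real n else 0) + (if int n dvd int j - int k - s then real n else 0)))"
    unfolding sum_distrib_left[symmetric] sum.distrib sum_cos_multiples[OF n] ..
  also have "\<dots> = real n / 2 * (\<Sum>j<n. \<Sum>k<n. f j * f k *
           ((if int n dvd int j - int k + s then 1 else 0) + (if int n dvd int j - int k - s then 1 else 0)))"
    unfolding sum_distrib_left by (intro sum.cong refl) (simp add: field_simps)
  finally show ?thesis .
qed

lemma dft_parseval:
  assumes n: "n > 0"
  shows "(\<Sum>m<n. dft_energy n f m) = real n * (\<Sum>k<n. (f k)\<^sup>2)"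
proof -
  have eq: "int n dvd int j - int k \<longleftrightarrow> k = j" if "j < n" "k < n" for j k
    using that by (metis diff_self dvd_0_right mod_eq_dvd_iff mod_less of_nat_eq_iff of_nat_mod)
  have "(\<Sum>m<n. dft_energy n f m) = real n / 2 * (\<Sum>j<n. \<Sum>k<n. f j * f k *
           ((if int n dvd int j - int k then 1 else 0) + (if int n dvd int j - int k then 1 else 0)))"
    using dft_energy_correlation[OF n, of f 0] by simp
  also have "\<dots> = real n / 2 * (\<Sum>j<n. \<Sum>k<n. if k = j then 2 * (f j)\<^sup>2 else 0)"
    by (intro arg_cong2[where f="(*)"] sum.cong refl) (auto simp: eq power2_eq_square)
  also have "\<dots> = real n / 2 * (\<Sum>j<n. 2 * (f j)\<^sup>2)"
    by (simp add: sum.delta)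
  finally show ?thesis by (simp add: sum_distrib_left[symmetric])
qed

lemma dft_autocorrelation:
  assumes n: "n > 0" and per: "f n = f 0"
  shows "(\<Sum>m<n. dft_energy n f m * cos (real m * (2 * pi / real n))) = real n * (\<Sum>k<n. f k * f (Suc k))"
proof -
  have eq: "int n dvd int j - int k - 1 \<longleftrightarrow> j = Suc k mod n" if "j < n" "k < n" for j k
  proof -
    have "int n dvd int j - int k - 1 \<longleftrightarrow> int j mod int n = int (Suc k) mod int n"
      by (simp add: mod_eq_dvd_iff algebra_simps)
    also have "\<dots> \<longleftrightarrow> j = Suc k mod n"
      using that by (metis mod_less of_nat_eq_iff of_nat_mod)
    finally show ?thesis .
  qed
  have eq': "int n dvd int j - int k + 1 \<longleftrightarrow> k = Suc j mod n" if "j < n" "k < n" for j k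
  proof -
    have "int j - int k + 1 = - (int k - int j - 1)" by simp
    then show ?thesis using eq[OF that(2,1)] by (metis dvd_minus_iff)
  qed
  have fm: "f (Suc k mod n) = f (Suc k)" if "k < n" for k
    using that per by (cases "Suc k = n") (auto simp: mod_less)
  have "(\<Sum>m<n. dft_energy n f m * cos (real m * (2 * pi / real n))) = real n / 2 * (\<Sum>j<n. \<Sum>k<n. f j * f k *
           ((if int n dvd int j - int k + 1 then 1 else 0) + (if int n dvd int j - int k - 1 then 1 else 0)))"
    using dft_energy_correlation[OF n, of f 1] by simp
  also have "(\<Sum>j<n. \<Sum>k<n. f j * f k *
           ((if int n dvd int j - int k + 1 then 1 else 0) + (if int n dvd int j - int k - 1 then 1 else 0)))
     = (\<Sum>j<n. \<Sum>k<n. if k = Suc j mod n then f j * f k else 0) + (\<Sum>j<n. \<Sum>k<n. if j = Suc k mod n then f j * f k else 0)"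
    unfolding sum.distrib[symmetric] by (intro sum.cong refl) (auto simp: eq eq')
  also have "(\<Sum>j<n. \<Sum>k<n. if j = Suc k mod n then f j * f k else 0) = (\<Sum>k<n. \<Sum>j<n. if j = Suc k mod n then f j * f k else 0)"
    by (rule sum.swap)
  also have "(\<Sum>j<n. \<Sum>k<n. if k = Suc j mod n then f j * f k else 0) = (\<Sum>k<n. f k * f (Suc k))"
    using n by (auto simp: sum.delta fm intro!: sum.cong)
  also have "(\<Sum>k<n. \<Sum>j<n. if j = Suc k mod n then f j * f k else 0) = (\<Sum>k<n. f k * f (Suc k))"
    using n by (auto simp: sum.delta fm intro!: sum.cong)
  finally show ?thesis by simp
qed

text \<open>The modes \<open>\<plusminus>1\<close> drop out, and all modes other than \<open>0, \<plusminus>1\<close> have frequency at least \<open>2\<delta>\<close> on the circle.\<close>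

lemma discrete_wirtinger:
  fixes f :: "nat \<Rightarrow> real"
  assumes n: "n \<ge> 4" and per: "f n = f 0"
  defines "\<delta> \<equiv> 2 * pi / real n"
  shows "real n * (\<Sum>k<n. f k * f (Suc k) - cos \<delta> * (f k)\<^sup>2)
     \<le> (1 - cos \<delta>) * (\<Sum>k<n. f k)\<^sup>2
       - (cos \<delta> - cos (2 * \<delta>)) * (real n * (\<Sum>k<n. (f k)\<^sup>2) - (\<Sum>k<n. f k)\<^sup>2
           - 2 * (\<Sum>k<n. f k * cos (real k * \<delta>))\<^sup>2 - 2 * (\<Sum>k<n. f k * sin (real k * \<delta>))\<^sup>2)"
proof -
  let ?e = "dft_energy n f"
  have n0: "n > 0" using n by simp
  have \<delta>: "\<delta> > 0" "real n * \<delta> = 2 * pi" using n0 by (simp_all add: \<delta>_def)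
  \<comment> \<open>Mode \<open>n - 1\<close> mirrors mode 1: the cosine part agrees and the sine
    part changes sign, so both have the energy \<open>e1\<close>.\<close>
  have refl_cs: "cos (real (n - 1) * (real k * \<delta>)) = cos (real k * \<delta>)"
    "sin (real (n - 1) * (real k * \<delta>)) = - sin (real k * \<delta>)" for k
  proof -
    have "real (n - 1) * (real k * \<delta>) = real k * (real n * \<delta>) - real k * \<delta>"
      using n0 by (simp add: of_nat_diff algebra_simps)
    also have "\<dots> = 2 * real k * pi - real k * \<delta>" using \<delta> by simp
    finally have *: "real (n - 1) * (real k * \<delta>) = 2 * real k * pi - real k * \<delta>" .
    show "cos (real (n - 1) * (real k * \<delta>)) = cos (real k * \<delta>)"
      "sin (real (n - 1) * (real k * \<delta>)) = - sin (real k * \<delta>)"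
      unfolding * by (simp_all add: cos_diff sin_diff)
  qed
  have e0: "?e 0 = (\<Sum>k<n. f k)\<^sup>2"
    by (simp add: dft_energy_def dft_cos_def dft_sin_def)
  define e1 where "e1 = (\<Sum>k<n. f k * cos (real k * \<delta>))\<^sup>2 + (\<Sum>k<n. f k * sin (real k * \<delta>))\<^sup>2"
  have e1: "?e 1 = e1" "?e (n - 1) = e1"
    unfolding e1_def dft_energy_def dft_cos_def dft_sin_def \<delta>_def[symmetric] refl_cs
    by (simp_all add: sum_negf)
  have "{..<n} = insert 0 (insert 1 (insert (n - 1) {2..<n - 1}))"
    using n by auto
  then have split: "(\<Sum>m<n. F m) = F 0 + F 1 + F (n - 1) + (\<Sum>m\<in>{2..<n - 1}. F m)" for F :: "nat \<Rightarrow> real"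
    using n by simp
  define r where "r = (\<Sum>m\<in>{2..<n - 1}. ?e m)"
  have P: "real n * (\<Sum>k<n. (f k)\<^sup>2) = ?e 0 + 2 * e1 + r"
    using dft_parseval[OF n0, of f] split[of ?e] unfolding e1 r_def by linarith
  \<comment> \<open>For these \<open>m\<close> the angle \<open>m * \<delta>\<close> lies between
    \<open>2 * \<delta>\<close> and \<open>2 * pi - 2 * \<delta>\<close>; beyond \<open>pi\<close>
    it is reflected so that monotonicity of the cosine applies.\<close>
  have cm: "cos (real m * \<delta>) \<le> cos (2 * \<delta>)" if "m \<in> {2..<n - 1}" for m
  proof (cases "real m * \<delta> \<le> pi")
    case True
    have "2 * \<delta> \<le> real m * \<delta>" using that \<delta> by (intro mult_right_mono) auto
    then show ?thesis using True \<delta> by (intro cos_monotone_0_pi_le) auto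
  next
    case False
    have "cos (real m * \<delta>) = cos (2 * pi - real m * \<delta>)" by (simp add: cos_diff)
    also have "\<dots> \<le> cos (2 * \<delta>)"
    proof (rule cos_monotone_0_pi_le)
      have "(real m + 2) * \<delta> \<le> real n * \<delta>" using that \<delta> by (intro mult_right_mono) auto
      then show "2 * \<delta> \<le> 2 * pi - real m * \<delta>" using \<delta> by (simp add: algebra_simps)
    qed (use False \<delta> in auto)
    finally show ?thesis .
  qed
  have "(\<Sum>m\<in>{2..<n - 1}. ?e m * cos (real m * \<delta>)) \<le> (\<Sum>m\<in>{2..<n - 1}. ?e m * cos (2 * \<delta>))"
    using cm by (intro sum_mono mult_left_mono) (auto simp: dft_energy_def)
  also have "\<dots> = r * cos (2 * \<delta>)" by (simp add: r_def sum_distrib_right)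
  finally have R: "(\<Sum>m\<in>{2..<n - 1}. ?e m * cos (real m * \<delta>)) \<le> r * cos (2 * \<delta>)" .
  have "real n * (\<Sum>k<n. f k * f (Suc k)) = ?e 0 + 2 * e1 * cos \<delta> + (\<Sum>m\<in>{2..<n - 1}. ?e m * cos (real m * \<delta>))"
    using dft_autocorrelation[of n f, OF n0 per] split[of "\<lambda>m. ?e m * cos (real m * \<delta>)"] refl_cs(1)[of 1]
    unfolding e1 \<delta>_def[symmetric] by simp
  with R have "real n * (\<Sum>k<n. f k * f (Suc k)) \<le> ?e 0 + 2 * e1 * cos \<delta> + r * cos (2 * \<delta>)" by simp
  moreover have "real n * (\<Sum>k<n. f k * f (Suc k) - cos \<delta> * (f k)\<^sup>2)
      = real n * (\<Sum>k<n. f k * f (Suc k)) - cos \<delta> * (real n * (\<Sum>k<n. (f k)\<^sup>2))"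
    by (simp add: sum_subtractf sum_distrib_left[symmetric] algebra_simps)
  ultimately have "real n * (\<Sum>k<n. f k * f (Suc k) - cos \<delta> * (f k)\<^sup>2)
      \<le> (1 - cos \<delta>) * ?e 0 - (cos \<delta> - cos (2 * \<delta>)) * r"
    unfolding P by (simp add: algebra_simps)
  also have "r = real n * (\<Sum>k<n. (f k)\<^sup>2) - ?e 0 - 2 * e1" using P by simp
  finally show ?thesis unfolding e0 e1_def by (simp only: right_diff_distrib distrib_left diff_diff_eq add.assoc)
qed

section \<open>Passage to the limit in the number of sides\<close>

lemma riemann_sum_tendsto:
  fixes f :: "real \<Rightarrow> real"
  assumes cont: "continuous_on {0..b} f" and b: "b > 0"
  shows "(\<lambda>n. b / real n * (\<Sum>k<n. f (real k * (b / real n)))) \<longlonglongrightarrow> integral {0..b} f"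
proof (rule LIMSEQ_I)
  fix r :: real assume r: "r > 0"
  \<comment> \<open>The total error is then at most \<open>e * b = r / 2\<close>, strictly below
    \<open>r\<close>.\<close>
  define e where "e = r / (2 * b)"
  have e: "e > 0" using r b by (simp add: e_def)
  have "uniformly_continuous_on {0..b} f"
    using cont compact_uniformly_continuous by blast
  then obtain d where d: "d > 0" "\<And>x y. x \<in> {0..b} \<Longrightarrow> y \<in> {0..b} \<Longrightarrow> dist y x < d \<Longrightarrow> dist (f y) (f x) < e"
    unfolding uniformly_continuous_on_def using e by metis
  obtain N :: nat where N: "real N > b / d" using reals_Archimedean2 by blast
  show "\<exists>no. \<forall>n\<ge>no. norm (b / real n * (\<Sum>k<n. f (real k * (b / real n))) - integral {0..b} f) < r"
  proof (intro exI[of _ "Suc N"] allI impI)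
    fix n assume "n \<ge> Suc N"
    then have nN: "real n > b / d" "n > 0" using N by auto
    define t where "t k = real k * (b / real n)" for k
    have t0: "t 0 = 0" "t n = b" using nN by (simp_all add: t_def)
    have tS: "t (Suc k) = t k + b / real n" for k by (simp add: t_def distrib_right add_divide_distrib)
    have small: "b / real n < d" using nN b d(1) by (simp add: field_simps)
    have tb: "0 \<le> t k" "t k \<le> b" if "k \<le> n" for k
      using that b nN by (auto simp: t_def field_simps)
    have int: "f integrable_on {x..y}" if "0 \<le> x" "y \<le> b" for x y
      using that by (intro integrable_continuous_real continuous_on_subset[OF cont]) auto
    have split: "integral {0..t k} f = (\<Sum>j<k. integral {t j..t (Suc j)} f)" if "k \<le> n" for k
      using that
    proof (induction k)
      case (Suc k)
      have "integral {0..t k} f + integral {t k..t (Suc k)} f = integral {0..t (Suc k)} f"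
        using Suc.prems tb[of k] tb[of "Suc k"] b nN
        by (intro Henstock_Kurzweil_Integration.integral_combine int) (auto simp: tS)
      then show ?case using Suc by simp
    qed (simp add: t0)
    have piece: "\<bar>b / real n * f (t k) - integral {t k..t (Suc k)} f\<bar> \<le> e * (b / real n)" if "k < n" for k
    proof -
      have le: "t k \<le> t (Suc k)" using b by (simp add: tS)
      have i: "f integrable_on {t k..t (Suc k)}" using that tb[of k] tb[of "Suc k"] by (intro int) auto
      have "b / real n * f (t k) - integral {t k..t (Suc k)} f = integral {t k..t (Suc k)} (\<lambda>x. f (t k) - f x)"
        by (subst Henstock_Kurzweil_Integration.integral_diff) (use i le in \<open>auto simp: tS\<close>)
      moreover have "norm (integral {t k..t (Suc k)} (\<lambda>x. f (t k) - f x)) \<le> integral {t k..t (Suc k)} (\<lambda>x. e)"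
      proof (rule integral_norm_bound_integral)
        fix x assume x: "x \<in> {t k..t (Suc k)}"
        have "dist (f (t k)) (f x) < e"
          using x that tb[of k] tb[of "Suc k"] small by (intro d(2)) (auto simp: dist_real_def tS)
        then show "norm (f (t k) - f x) \<le> e" by (simp add: dist_norm)
      qed (use i in \<open>auto intro!: integrable_diff\<close>)
      ultimately show ?thesis using le by (simp add: tS mult.commute)
    qed
    have "\<bar>(\<Sum>k<n. b / real n * f (t k) - integral {t k..t (Suc k)} f)\<bar> \<le> (\<Sum>k<n. e * (b / real n))"
      by (rule order.trans[OF sum_abs sum_mono]) (use piece in auto)
    also have "\<dots> = r / 2" using nN b by (simp add: e_def)
    finally have "\<bar>b / real n * (\<Sum>k<n. f (t k)) - integral {0..b} f\<bar> \<le> r / 2"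
      using split[of n] t0 by (simp add: sum_subtractf sum_distrib_left)
    then show "norm (b / real n * (\<Sum>k<n. f (real k * (b / real n))) - integral {0..b} f) < r"
      using r by (simp add: t_def)
  qed
qed

text \<open>With step \<open>d\<close>, multiplying the discrete inequality by \<open>2 * d\<close>
  makes its left side \<open>4 * pi * A * sin d\<close>, because \<open>n * d = 2 * pi\<close>.
  After division by \<open>sin d\<close> the sums become Riemann sums, and the quotients
  \<open>(1 - cos d) / d\<^sup>2\<close> and \<open>(cos d - cos (2 * d)) / d\<^sup>2\<close> tend
  to 1/2 and 3/2; doubled, these are the coefficients 1 and 3.\<close>

lemma continuous_deficit_bound:
  fixes h :: "real \<Rightarrow> real" and A :: real
  assumes cont: "continuous_on {0..2*pi} h" and per: "h (2 * pi) = h 0"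
    and A: "\<And>m. m \<ge> 1 \<Longrightarrow> A \<le> (\<Sum>k<4*m. h (real k * (2 * pi / real (4*m))) * h (real (Suc k) * (2 * pi / real (4*m)))
          - cos (2 * pi / real (4*m)) * (h (real k * (2 * pi / real (4*m))))\<^sup>2) / sin (2 * pi / real (4*m))"
  shows "4 * pi * A \<le> (integral {0..2*pi} h)\<^sup>2
    - 3 * (2 * pi * integral {0..2*pi} (\<lambda>x. (h x)\<^sup>2) - (integral {0..2*pi} h)\<^sup>2
       - 2 * (integral {0..2*pi} (\<lambda>x. h x * cos x))\<^sup>2 - 2 * (integral {0..2*pi} (\<lambda>x. h x * sin x))\<^sup>2)"
proof -
  define R where "R f n = 2 * pi / real n * (\<Sum>k<n. f (real k * (2 * pi / real n)))" for f :: "real \<Rightarrow> real" and n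
  have R: "(\<lambda>m. R f (4 * m)) \<longlonglongrightarrow> integral {0..2*pi} f" if "continuous_on {0..2*pi} f" for f
  proof -
    have "(\<lambda>n. R f n) \<longlonglongrightarrow> integral {0..2*pi} f"
      unfolding R_def by (rule riemann_sum_tendsto[OF that]) simp
    then show ?thesis
      by (rule filterlim_compose) (rule mult_nat_left_at_top, simp)
  qed
  define d where "d m = 2 * pi / real (4 * m)" for m :: nat
  define G where "G m = (R h (4*m))\<^sup>2" for m
  define H where "H m = 2 * pi * R (\<lambda>x. (h x)\<^sup>2) (4*m) - (R h (4*m))\<^sup>2 - 2 * (R (\<lambda>x. h x * cos x) (4*m))\<^sup>2
      - 2 * (R (\<lambda>x. h x * sin x) (4*m))\<^sup>2" for m
  define U where "U m = d m / sin (d m) * ((1 - cos (d m)) / (d m)\<^sup>2 * 2 * G m - (cos (d m) - cos (2 * d m)) / (d m)\<^sup>2 * 2 * H m)" for m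
  have bound: "4 * pi * A \<le> U m" if m: "m \<ge> 1" for m
  proof -
    let ?n = "4 * m" and ?d = "d m"
    have n: "?n \<ge> 4" "real ?n * ?d = 2 * pi" "?d > 0" using m by (simp_all add: d_def)
    have d2: "?d \<le> pi / 2" using m by (simp add: d_def field_simps)
    have sd: "sin ?d > 0" using n d2 pi_gt_zero by (intro sin_gt_zero) linarith+
    let ?S = "\<lambda>f. \<Sum>k<?n. f (real k * ?d)"
    let ?S1 = "\<Sum>k<?n. h (real k * ?d)" and ?S2 = "\<Sum>k<?n. (h (real k * ?d))\<^sup>2"
    let ?Sc = "\<Sum>k<?n. h (real k * ?d) * cos (real k * ?d)" and ?Ss = "\<Sum>k<?n. h (real k * ?d) * sin (real k * ?d)"
    have RS: "R f ?n = ?d * ?S f" for f by (simp add: R_def d_def)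
    have "A \<le> (\<Sum>k<?n. h (real k * ?d) * h (real (Suc k) * ?d) - cos ?d * (h (real k * ?d))\<^sup>2) / sin ?d"
      using A[OF m] by (simp only: d_def)
    then have "A * sin ?d \<le> (\<Sum>k<?n. h (real k * ?d) * h (real (Suc k) * ?d) - cos ?d * (h (real k * ?d))\<^sup>2)"
      using sd by (simp add: pos_le_divide_eq)
    then have "real ?n * (A * sin ?d) \<le> real ?n * (\<Sum>k<?n. h (real k * ?d) * h (real (Suc k) * ?d) - cos ?d * (h (real k * ?d))\<^sup>2)"
      by (intro mult_left_mono) auto
    also have "\<dots> \<le> (1 - cos ?d) * ?S1\<^sup>2 - (cos ?d - cos (2 * ?d)) * (real ?n * ?S2 - ?S1\<^sup>2 - 2 * ?Sc\<^sup>2 - 2 * ?Ss\<^sup>2)"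
    proof -
      have "h (real ?n * ?d) = h (real 0 * ?d)" unfolding n(2) using per by simp
      from discrete_wirtinger[of ?n "\<lambda>k. h (real k * ?d)", OF n(1) this] show ?thesis
        unfolding d_def .
    qed
    finally have "?d * 2 * (real ?n * (A * sin ?d)) \<le> ?d * 2 * ((1 - cos ?d) * ?S1\<^sup>2 - (cos ?d - cos (2 * ?d)) * (real ?n * ?S2 - ?S1\<^sup>2 - 2 * ?Sc\<^sup>2 - 2 * ?Ss\<^sup>2))"
      using n by (intro mult_left_mono) auto
    moreover have "?d * 2 * (real ?n * (A * sin ?d)) = 4 * pi * A * sin ?d"
    proof -
      have "?d * 2 * (real ?n * (A * sin ?d)) = 2 * (real ?n * ?d) * A * sin ?d" by simp
      then show ?thesis unfolding n(2) by simp
    qed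
    moreover have "?d * 2 * ((1 - cos ?d) * ?S1\<^sup>2 - (cos ?d - cos (2 * ?d)) * (real ?n * ?S2 - ?S1\<^sup>2 - 2 * ?Sc\<^sup>2 - 2 * ?Ss\<^sup>2)) = sin ?d * U m"
    proof -
      have G: "G m = ?d\<^sup>2 * ?S1\<^sup>2" by (simp add: G_def RS power_mult_distrib)
      have "2 * pi * (?d * ?S2) = ?d\<^sup>2 * (real ?n * ?S2)"
        unfolding n(2)[symmetric] by (simp add: power2_eq_square)
      then have H: "H m = ?d\<^sup>2 * (real ?n * ?S2 - ?S1\<^sup>2 - 2 * ?Sc\<^sup>2 - 2 * ?Ss\<^sup>2)"
        by (simp add: H_def RS power_mult_distrib right_diff_distrib)
      have gen: "sin x * (x / sin x * (a / x\<^sup>2 * 2 * (x\<^sup>2 * g) - b / x\<^sup>2 * 2 * (x\<^sup>2 * k))) = x * 2 * (a * g - b * k)"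
        if "sin x > 0" "x > 0" for x a g b k :: real
        using that by (simp add: algebra_simps)
      show ?thesis unfolding U_def G H by (rule gen[OF sd n(3), symmetric])
    qed
    ultimately have "4 * pi * A * sin ?d \<le> sin ?d * U m" by (simp only:)
    then have "sin ?d * (4 * pi * A) \<le> sin ?d * U m" by (simp only: mult.commute)
    then show ?thesis using sd by (simp only: mult_le_cancel_left_pos)
  qed
  have dlim: "filterlim d (at_right 0) sequentially"
    unfolding d_def by real_asymp
  have l1: "((\<lambda>x::real. x / sin x) \<longlongrightarrow> 1) (at_right 0)" by real_asymp
  have l2: "((\<lambda>x::real. (1 - cos x) / x\<^sup>2) \<longlongrightarrow> 1/2) (at_right 0)" by real_asymp
  have l3: "((\<lambda>x::real. (cos x - cos (2 * x)) / x\<^sup>2) \<longlongrightarrow> 3/2) (at_right 0)" by real_asymp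
  let ?I = "integral {0..2*pi} h"
  let ?D = "2 * pi * integral {0..2*pi} (\<lambda>x. (h x)\<^sup>2) - ?I\<^sup>2
       - 2 * (integral {0..2*pi} (\<lambda>x. h x * cos x))\<^sup>2 - 2 * (integral {0..2*pi} (\<lambda>x. h x * sin x))\<^sup>2"
  have Gl: "G \<longlonglongrightarrow> ?I\<^sup>2" unfolding G_def by (intro tendsto_intros R cont)
  have Hl: "H \<longlonglongrightarrow> ?D" unfolding H_def by (intro tendsto_intros R continuous_intros cont)
  have "U \<longlonglongrightarrow> 1 * (1/2 * 2 * ?I\<^sup>2 - 3/2 * 2 * ?D)"
    unfolding U_def
    by (intro tendsto_mult tendsto_diff tendsto_const Gl Hl filterlim_compose[OF l1 dlim]
        filterlim_compose[OF l2 dlim] filterlim_compose[OF l3 dlim])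
  then have "4 * pi * A \<le> 1 * (1/2 * 2 * ?I\<^sup>2 - 3/2 * 2 * ?D)"
    by (rule tendsto_lowerbound) (use bound in \<open>auto simp: eventually_sequentially\<close>)
  then show ?thesis by simp
qed

section \<open>The equality case and the strict inequality\<close>

lemma trig_integrals:
  shows "(cos has_integral 0) {0..2*pi}" "(sin has_integral 0) {0..2*pi}"
    "((\<lambda>x. (cos x)\<^sup>2) has_integral pi) {0..2*pi}" "((\<lambda>x. (sin x)\<^sup>2) has_integral pi) {0..2*pi}"
    "((\<lambda>x. sin x * cos x) has_integral 0) {0..2*pi}"
proof -
  have "(cos has_integral (sin (2*pi) - sin 0)) {0..2*pi}"
    by (intro fundamental_theorem_of_calculus)
      (auto intro!: derivative_eq_intros simp flip: has_real_derivative_iff_has_vector_derivative)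
  then show "(cos has_integral 0) {0..2*pi}" by simp
  have "(sin has_integral (- cos (2*pi) - (- cos 0))) {0..2*pi}"
    by (intro fundamental_theorem_of_calculus)
      (auto intro!: derivative_eq_intros simp flip: has_real_derivative_iff_has_vector_derivative)
  then show "(sin has_integral 0) {0..2*pi}" by simp
  have "((\<lambda>x. (cos x)\<^sup>2) has_integral ((2*pi + sin (2*pi) * cos (2*pi)) / 2 - (0 + sin 0 * cos 0) / 2)) {0..2*pi}"
  proof (intro fundamental_theorem_of_calculus)
    fix x :: real
    have "((\<lambda>x. (x + sin x * cos x) / 2) has_real_derivative (1 + (cos x * cos x - sin x * sin x)) / 2) (at x within {0..2*pi})"
      by (auto intro!: derivative_eq_intros)
    also have "(1 + (cos x * cos x - sin x * sin x)) / 2 = (cos x)\<^sup>2"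
      using sin_cos_squared_add[of x] by (simp add: power2_eq_square)
    finally show "((\<lambda>x. (x + sin x * cos x) / 2) has_vector_derivative (cos x)\<^sup>2) (at x within {0..2*pi})"
      by (simp add: has_real_derivative_iff_has_vector_derivative)
  qed simp
  then show cos2: "((\<lambda>x. (cos x)\<^sup>2) has_integral pi) {0..2*pi}" by simp
  have "((\<lambda>x::real. 1 - (cos x)\<^sup>2) has_integral (2 * pi - pi)) {0..2*pi}"
    using has_integral_const_real[of "1::real" 0 "2*pi"] by (intro has_integral_diff cos2) auto
  then show "((\<lambda>x. (sin x)\<^sup>2) has_integral pi) {0..2*pi}"
    by (simp add: sin_squared_eq)
  have "((\<lambda>x. sin x * cos x) has_integral ((sin (2*pi))\<^sup>2 / 2 - (sin 0)\<^sup>2 / 2)) {0..2*pi}"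
    by (intro fundamental_theorem_of_calculus)
      (auto intro!: derivative_eq_intros simp flip: has_real_derivative_iff_has_vector_derivative)
  then show "((\<lambda>x. sin x * cos x) has_integral 0) {0..2*pi}" by simp
qed

text \<open>\<open>D\<close> is \<open>2\<pi>\<close> times the squared \<open>L\<^sup>2\<close> distance from \<open>h\<close> to the span of \<open>1, cos, sin\<close>.\<close>

lemma first_harmonics_deficit:
  fixes h :: "real \<Rightarrow> real"
  assumes cont: "continuous_on {0..2*pi} h"
  defines "a \<equiv> integral {0..2*pi} h / (2*pi)"
    and "b \<equiv> integral {0..2*pi} (\<lambda>x. h x * cos x) / pi"
    and "c \<equiv> integral {0..2*pi} (\<lambda>x. h x * sin x) / pi"
    and "D \<equiv> 2 * pi * integral {0..2*pi} (\<lambda>x. (h x)\<^sup>2) - (integral {0..2*pi} h)\<^sup>2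
       - 2 * (integral {0..2*pi} (\<lambda>x. h x * cos x))\<^sup>2 - 2 * (integral {0..2*pi} (\<lambda>x. h x * sin x))\<^sup>2"
  shows "D \<ge> 0" and "D = 0 \<Longrightarrow> x \<in> {0..2*pi} \<Longrightarrow> h x = a + b * cos x + c * sin x"
proof -
  define q where "q x = h x - a - b * cos x - c * sin x" for x
  have qc: "continuous_on {0..2*pi} (\<lambda>x. (q x)\<^sup>2)"
    unfolding q_def by (intro continuous_intros cont)
  have int: "(f has_integral (integral {0..2*pi} f)) {0..2*pi}" if "continuous_on {0..2*pi} f" for f :: "real \<Rightarrow> real"
    using that by (intro integrable_integral integrable_continuous_real)
  \<comment> \<open>This integrates the expanded square of \<open>q\<close> term by term; the mixed
    products of 1, \<open>cos\<close> and \<open>sin\<close> contribute zero.\<close>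
  have "((\<lambda>x. (h x)\<^sup>2 + a\<^sup>2 + b\<^sup>2 * (cos x)\<^sup>2 + c\<^sup>2 * (sin x)\<^sup>2 - 2 * a * h x - 2 * b * (h x * cos x)
      - 2 * c * (h x * sin x) + 2 * a * b * cos x + 2 * a * c * sin x + 2 * b * c * (sin x * cos x))
    has_integral (integral {0..2*pi} (\<lambda>x. (h x)\<^sup>2) + 2 * pi * a\<^sup>2 + b\<^sup>2 * pi + c\<^sup>2 * pi
      - 2 * a * integral {0..2*pi} h - 2 * b * integral {0..2*pi} (\<lambda>x. h x * cos x)
      - 2 * c * integral {0..2*pi} (\<lambda>x. h x * sin x) + 2 * a * b * 0 + 2 * a * c * 0 + 2 * b * c * 0)) {0..2*pi}"
    (is "(?f has_integral ?v) _")
    using has_integral_const_real[of "a\<^sup>2" 0 "2*pi"]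
    by (intro has_integral_add has_integral_diff has_integral_mult_right trig_integrals int continuous_intros cont) simp
  moreover have "?f = (\<lambda>x. (q x)\<^sup>2)"
    by (rule ext) (simp add: q_def power2_eq_square algebra_simps)
  ultimately have "((\<lambda>x. (q x)\<^sup>2) has_integral ?v) {0..2*pi}" by (simp only:)
  then have "integral {0..2*pi} (\<lambda>x. (q x)\<^sup>2) = ?v" by (rule integral_unique)
  moreover have "integral {0..2*pi} h = 2 * pi * a" "integral {0..2*pi} (\<lambda>x. h x * cos x) = pi * b"
    "integral {0..2*pi} (\<lambda>x. h x * sin x) = pi * c"
    by (simp_all add: a_def b_def c_def)
  moreover have "2 * pi * J - (2 * pi * a)\<^sup>2 - 2 * (pi * b)\<^sup>2 - 2 * (pi * c)\<^sup>2
      = 2 * pi * (J + 2 * pi * a\<^sup>2 + b\<^sup>2 * pi + c\<^sup>2 * pi - 2 * a * (2 * pi * a) - 2 * b * (pi * b)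
        - 2 * c * (pi * c) + 2 * a * b * 0 + 2 * a * c * 0 + 2 * b * c * 0)" for J
    by (simp add: power2_eq_square algebra_simps)
  ultimately have D: "D = 2 * pi * integral {0..2*pi} (\<lambda>x. (q x)\<^sup>2)"
    unfolding D_def by (simp only:)
  have "integral {0..2*pi} (\<lambda>x. (q x)\<^sup>2) \<ge> 0"
    by (intro Henstock_Kurzweil_Integration.integral_nonneg integrable_continuous_real qc) simp
  then show "D \<ge> 0" unfolding D by (intro mult_nonneg_nonneg) simp_all
  assume "D = 0" and x: "x \<in> {0..2*pi}"
  then have "integral {0..2*pi} (\<lambda>x. (q x)\<^sup>2) = 0" unfolding D by simp
  then have "\<forall>x\<in>{0..2*pi}. (q x)\<^sup>2 = 0"
    by (subst (asm) integral_eq_0_iff[OF qc]) simp_all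
  then have "q x = 0" using x by simp
  then show "h x = a + b * cos x + c * sin x" by (simp add: q_def)
qed

text \<open>A compact convex set is determined by its support function, and
  \<open>a + p \<bullet> dir \<theta>\<close> is that of the ball. A point of \<open>X\<close> is
  tested in its own direction from \<open>p\<close>; a point outside \<open>X\<close> is tested in
  the direction normal to a line separating it from \<open>X\<close>.\<close>

lemma cball_of_support_fun:
  assumes X: "compact X" "convex X" "X \<noteq> {}"
    and h: "\<And>\<theta>. \<theta> \<in> {0..2*pi} \<Longrightarrow> support_fun X \<theta> = a + p \<bullet> dir \<theta>"
  shows "X = cball p a"
proof (intro equalityI subsetI)
  fix x assume x: "x \<in> X"
  obtain \<phi> where \<phi>: "\<phi> \<in> {0..2*pi}" "x - p = norm (x - p) *\<^sub>R dir \<phi>"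
    using polar_real2 by blast
  define s where "s = norm (x - p)"
  have xp: "x - p = s *\<^sub>R dir \<phi>" using \<phi>(2) unfolding s_def .
  have "s = (x - p) \<bullet> dir \<phi>" unfolding xp by (simp add: inner_dir_dir)
  also have "\<dots> \<le> a" using support_fun_upper[OF X(1) x, of \<phi>] h[OF \<phi>(1)] by (simp add: inner_diff_left)
  finally show "x \<in> cball p a" by (simp add: s_def dist_norm norm_minus_commute)
next
  fix x assume x: "x \<in> cball p a"
  show "x \<in> X"
  proof (rule ccontr)
    assume "x \<notin> X"
    then obtain w t where w: "w \<bullet> x < t" "\<And>y. y \<in> X \<Longrightarrow> w \<bullet> y > t"
      using separating_hyperplane_closed_point[OF X(2) compact_imp_closed[OF X(1)]] by blast
    obtain \<phi> where \<phi>: "\<phi> \<in> {0..2*pi}" "- w = norm (- w) *\<^sub>R dir \<phi>"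
      using polar_real2 by blast
    obtain y where y: "y \<in> X" "y \<bullet> dir \<phi> = support_fun X \<phi>"
      using support_fun_attained[OF X(1,3)] .
    define s where "s = norm (- w)"
    have ws: "w = - (s *\<^sub>R dir \<phi>)" using \<phi>(2) unfolding s_def by (metis minus_minus)
    have "w \<bullet> x < w \<bullet> y" using w(1) w(2)[OF y(1)] by simp
    then have "s * (y \<bullet> dir \<phi>) < s * (x \<bullet> dir \<phi>)"
      unfolding ws by (simp add: inner_commute)
    then have "y \<bullet> dir \<phi> < x \<bullet> dir \<phi>"
      by (rule mult_left_less_imp_less) (simp add: s_def)
    then have "a < (x - p) \<bullet> dir \<phi>" using y(2) h[OF \<phi>(1)] by (simp add: inner_diff_left)
    also have "\<dots> \<le> norm (x - p)" using norm_cauchy_schwarz[of "x - p" "dir \<phi>"] by simp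
    finally show False using x by (simp add: dist_norm norm_minus_commute)
  qed
qed

text \<open>If the deficit \<open>?D\<close> vanished, the support function would be a constant plus
  a first harmonic and \<open>X\<close> would be a disk. So the deficit is positive, and three times
  it is the gap in the inequality.\<close>

lemma mean_width_isoperimetric_strict_0:
  assumes X: "compact X" "convex X" "0 \<in> X" and nb: "\<And>c r. X \<noteq> cball c r"
  shows "4 * pi * measure lebesgue X < (integral {0..2*pi} (support_fun X))\<^sup>2"
proof -
  let ?h = "support_fun X"
  let ?D = "2 * pi * integral {0..2*pi} (\<lambda>x. (?h x)\<^sup>2) - (integral {0..2*pi} ?h)\<^sup>2
       - 2 * (integral {0..2*pi} (\<lambda>x. ?h x * cos x))\<^sup>2 - 2 * (integral {0..2*pi} (\<lambda>x. ?h x * sin x))\<^sup>2"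
  have ne: "X \<noteq> {}" using X by auto
  have cont: "continuous_on {0..2*pi} ?h" by (rule continuous_on_support_fun[OF X(1) ne])
  have "4 * pi * measure lebesgue X \<le> (integral {0..2*pi} ?h)\<^sup>2 - 3 * ?D"
  proof (rule continuous_deficit_bound[OF cont])
    show "?h (2 * pi) = ?h 0" using support_fun_2pi[of X 0] by simp
  qed (rule measure_le_circumscribed[OF X(1,3)])
  moreover have "?D \<noteq> 0"
  proof
    assume D: "?D = 0"
    let ?p = "vector [integral {0..2*pi} (\<lambda>x. ?h x * cos x) / pi, integral {0..2*pi} (\<lambda>x. ?h x * sin x) / pi] :: real^2"
    have "X = cball ?p (integral {0..2*pi} ?h / (2 * pi))"
      by (rule cball_of_support_fun[OF X(1,2) ne])
        (use first_harmonics_deficit(2)[OF cont D] in \<open>simp add: inner_dir\<close>)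
    then show False using nb by blast
  qed
  then have "?D > 0" using first_harmonics_deficit(1)[OF cont] by (simp only: less_le simp_thms)
  moreover have "u \<le> v - 3 * d \<Longrightarrow> d > 0 \<Longrightarrow> u < v" for u v d :: real by simp
  ultimately show ?thesis by blast
qed

text \<open>A translation adds a first harmonic to the support function, whose integral over a full
  turn is zero. Neither side changes, so a point of \<open>X\<close> may be moved to the
  origin.\<close>

lemma mean_width_isoperimetric_strict:
  assumes X: "compact X" "convex X" "X \<noteq> {}" and nb: "\<And>c r. X \<noteq> cball c r"
  shows "4 * pi * measure lebesgue X < (integral {0..2*pi} (support_fun X))\<^sup>2"
proof -
  obtain p where p: "p \<in> X" using X by auto
  define Y where "Y = (\<lambda>x. x - p) ` X"
  have Y: "compact Y" "convex Y" "0 \<in> Y"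
    unfolding Y_def using X p
    by (auto intro!: compact_continuous_image continuous_intros convex_translation_subtract)
  have XY: "X = (+) p ` Y" by (auto simp: Y_def image_image)
  have "Y \<noteq> cball c r" for c r
  proof
    assume "Y = cball c r"
    then have "X = cball (p + c) r" unfolding XY by (simp only: cball_translation)
    then show False using nb by blast
  qed
  then have "4 * pi * measure lebesgue Y < (integral {0..2*pi} (support_fun Y))\<^sup>2"
    by (intro mean_width_isoperimetric_strict_0 Y) auto
  moreover have "measure lebesgue Y = measure lebesgue X"
    unfolding Y_def by (rule measure_translation_subtract)
  moreover have "integral {0..2*pi} (support_fun Y) = integral {0..2*pi} (support_fun X)"
  proof -
    have "support_fun Y \<theta> = support_fun X \<theta> - (p$1 * cos \<theta> + p$2 * sin \<theta>)" for \<theta>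
    proof -
      obtain x where x: "x \<in> X" "x \<bullet> dir \<theta> = support_fun X \<theta>" using support_fun_attained[OF X(1,3)] .
      obtain y where y: "y \<in> Y" "y \<bullet> dir \<theta> = support_fun Y \<theta>" using support_fun_attained[of Y \<theta>] Y by blast
      have "x - p \<in> Y" using x by (auto simp: Y_def)
      from support_fun_upper[OF Y(1) this, of \<theta>] have 1: "support_fun X \<theta> - p \<bullet> dir \<theta> \<le> support_fun Y \<theta>"
        using x by (simp add: inner_diff_left)
      have "p + y \<in> X" using y XY by blast
      from support_fun_upper[OF X(1) this, of \<theta>] have "support_fun Y \<theta> + p \<bullet> dir \<theta> \<le> support_fun X \<theta>"
        using y by (simp add: inner_add_left)
      with 1 show ?thesis by (simp add: inner_dir)
    qed
    then have "support_fun Y = (\<lambda>\<theta>. support_fun X \<theta> - (p$1 * cos \<theta> + p$2 * sin \<theta>))" by (rule ext)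
    moreover have "((\<lambda>\<theta>. support_fun X \<theta> - (p$1 * cos \<theta> + p$2 * sin \<theta>)) has_integral
        (integral {0..2*pi} (support_fun X) - (p$1 * 0 + p$2 * 0))) {0..2*pi}"
      by (intro has_integral_diff has_integral_add has_integral_mult_right trig_integrals integrable_integral
          integrable_continuous_real continuous_on_support_fun X)
    ultimately show ?thesis by (simp add: integral_unique)
  qed
  ultimately show ?thesis by simp
qed

section \<open>Mean width and perimeter\<close>

lemma integral_periodic_shift:
  fixes f :: "real \<Rightarrow> real"
  assumes cont: "continuous_on UNIV f" and per: "\<And>x. f (x + p) = f x" and c: "0 \<le> c" "c \<le> p"
  shows "integral {0..p} (\<lambda>x. f (x + c)) = integral {0..p} f"
proof -
  have co: "continuous_on S f" for S using cont by (rule continuous_on_subset) simp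
  have int: "f integrable_on {a..b}" for a b by (intro integrable_continuous_real co)
  have "integral {0..p} (\<lambda>x. f (x + c)) = integral {c..p + c} f"
    using integral_shift[of 0 c p f, OF co] by (simp add: o_def)
  also have "\<dots> = integral {c..p} f + integral {p..p + c} f"
    by (rule Henstock_Kurzweil_Integration.integral_combine[symmetric]) (use c int in auto)
  also have "integral {p..p + c} f = integral {0..c} (\<lambda>x. f (x + p))"
    using integral_shift[of 0 p c f, OF co] by (simp add: o_def add.commute)
  also have "\<dots> = integral {0..c} f" by (simp add: per)
  also have "integral {c..p} f + integral {0..c} f = integral {0..p} f"
    using Henstock_Kurzweil_Integration.integral_combine[of 0 c p f] c int by simp
  finally show ?thesis .
qed

text \<open>Crofton's formula for a single segment: shifting the angle reduces the integrand to
  \<open>norm e\<close> times the absolute cosine. Summed over edges it recovers the length of a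
  polygon from its projections.\<close>

lemma integral_abs_inner_dir: "integral {0..2*pi} (\<lambda>\<theta>. \<bar>e \<bullet> dir \<theta>\<bar>) = 4 * norm e"
proof -
  have "((\<lambda>x::real. sin x) has_integral (- cos pi - - cos 0)) {0..pi}"
    by (intro fundamental_theorem_of_calculus)
      (auto intro!: derivative_eq_intros simp flip: has_real_derivative_iff_has_vector_derivative)
  then have 1: "((\<lambda>x. \<bar>sin x\<bar>) has_integral 2) {0..pi}"
    by (rule has_integral_eq_rhs[OF has_integral_eq, rotated]) (auto simp: sin_ge_zero)
  have "((\<lambda>x::real. - sin x) has_integral (cos (2*pi) - cos pi)) {pi..2*pi}"
    by (intro fundamental_theorem_of_calculus)
      (auto intro!: derivative_eq_intros simp flip: has_real_derivative_iff_has_vector_derivative)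
  moreover have "\<bar>sin x\<bar> = - sin x" if "pi \<le> x" "x \<le> 2*pi" for x
    using sin_ge_zero[of "x - pi"] that by (simp add: sin_diff)
  ultimately have "((\<lambda>x. \<bar>sin x\<bar>) has_integral (cos (2*pi) - cos pi)) {pi..2*pi}"
    using has_integral_eq[of "{pi..2*pi}" "\<lambda>x. - sin x" "\<lambda>x. \<bar>sin x\<bar>"] by simp
  then have 2: "((\<lambda>x. \<bar>sin x\<bar>) has_integral 2) {pi..2*pi}" by simp
  have "((\<lambda>x::real. \<bar>sin x\<bar>) has_integral 2 + 2) {0..2*pi}"
    by (rule has_integral_combine[OF _ _ 1 2]) auto
  then have "integral {0..2*pi} (\<lambda>x. \<bar>sin x\<bar>) = 4" by (simp add: integral_unique)
  then have "integral {0..2*pi} (\<lambda>x. \<bar>sin (x + pi/2)\<bar>) = 4"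
    using integral_periodic_shift[of "\<lambda>x. \<bar>sin x\<bar>" "2*pi" "pi/2"]
    by (simp add: continuous_on_rabs continuous_on_sin)
  then have c: "integral {0..2*pi} (\<lambda>x. \<bar>cos x\<bar>) = 4" by (simp add: sin_add)
  obtain \<phi> where \<phi>: "\<phi> \<in> {0..2*pi}" "e = norm e *\<^sub>R dir \<phi>" using polar_real2 by blast
  define s where "s = norm e"
  have e: "e = s *\<^sub>R dir \<phi>" using \<phi>(2) unfolding s_def .
  have s0: "s \<ge> 0" by (simp add: s_def)
  have "\<bar>e \<bullet> dir \<theta>\<bar> = s * \<bar>cos (\<theta> + (2*pi - \<phi>))\<bar>" for \<theta>
  proof -
    have "cos (\<theta> + (2*pi - \<phi>)) = cos (\<phi> - \<theta>)"
      by (simp add: cos_add cos_diff sin_diff)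
    then show ?thesis unfolding e using s0 by (simp add: inner_dir_dir abs_mult)
  qed
  then have "integral {0..2*pi} (\<lambda>\<theta>. \<bar>e \<bullet> dir \<theta>\<bar>) = s * integral {0..2*pi} (\<lambda>\<theta>. \<bar>cos (\<theta> + (2*pi - \<phi>))\<bar>)"
    by (simp only: integral_mult_right)
  also have "integral {0..2*pi} (\<lambda>\<theta>. \<bar>cos (\<theta> + (2*pi - \<phi>))\<bar>) = integral {0..2*pi} (\<lambda>x. \<bar>cos x\<bar>)"
    by (rule integral_periodic_shift[of "\<lambda>x. \<bar>cos x\<bar>"]) (use \<phi>(1) in \<open>simp_all add: continuous_on_rabs continuous_on_cos\<close>)
  finally show ?thesis using c by (simp add: s_def)
qed

lemma abs_diff_le_variation:
  fixes f :: "nat \<Rightarrow> real"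
  assumes "i \<le> j"
  shows "\<bar>f j - f i\<bar> \<le> (\<Sum>k\<in>{i..<j}. \<bar>f (Suc k) - f k\<bar>)"
proof -
  have "f j - f i = (\<Sum>k\<in>{i..<j}. f (Suc k) - f k)" using sum_Suc_diff'[OF assms, of f] by simp
  then show ?thesis by (simp only: sum_abs)
qed

text \<open>A closed sequence passes between its values at \<open>a\<close> and \<open>b\<close>
  twice: once along the indices between them, and once the other way around, through
  \<open>f N = f 0\<close>.\<close>

lemma closed_variation_ge:
  fixes f :: "nat \<Rightarrow> real"
  assumes "f N = f 0" "a \<le> N" "b \<le> N"
  shows "2 * (f a - f b) \<le> (\<Sum>k<N. \<bar>f (Suc k) - f k\<bar>)"
proof -
  have main: "2 * \<bar>f b - f a\<bar> \<le> (\<Sum>k<N. \<bar>f (Suc k) - f k\<bar>)" if "a \<le> b" "b \<le> N" for a b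
  proof -
    define v where "v k = \<bar>f (Suc k) - f k\<bar>" for k
    have "(\<Sum>k<N. v k) = sum v {0..<a} + sum v {a..<b} + sum v {b..<N}"
      using that by (simp add: sum.atLeastLessThan_concat lessThan_atLeast0)
    moreover have "\<bar>f a - f 0\<bar> \<le> sum v {0..<a}" "\<bar>f b - f a\<bar> \<le> sum v {a..<b}" "\<bar>f N - f b\<bar> \<le> sum v {b..<N}"
      using that unfolding v_def by (auto intro: abs_diff_le_variation)
    moreover have "\<bar>f b - f a\<bar> \<le> \<bar>f a - f 0\<bar> + \<bar>f N - f b\<bar>"
      unfolding assms(1) by linarith
    moreover have "s = p + q + r \<Longrightarrow> x \<le> p \<Longrightarrow> y \<le> q \<Longrightarrow> z \<le> r \<Longrightarrow> y \<le> x + z \<Longrightarrow> 2 * y \<le> s"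
      for s p q r x y z :: real by simp
    ultimately have "2 * \<bar>f b - f a\<bar> \<le> (\<Sum>k<N. v k)" by blast
    then show ?thesis by (simp only: v_def)
  qed
  have "2 * (f a - f b) \<le> 2 * \<bar>f b - f a\<bar>"
    using abs_ge_minus_self[of "f b - f a"] by simp
  also have "\<dots> \<le> (\<Sum>k<N. \<bar>f (Suc k) - f k\<bar>)"
    using main[of a b] main[of b a] assms(2,3) abs_minus_commute[of "f a" "f b"] by (metis nat_le_linear)
  finally show ?thesis .
qed

text \<open>An interior maximizer could be moved a little further along \<open>dir \<theta>\<close>.
  Thus a curve that runs only through the frontier still meets every support point.\<close>

lemma maximizer_in_frontier:
  assumes X: "compact X" "x \<in> X" and m: "x \<bullet> dir \<theta> = support_fun X \<theta>"
  shows "x \<in> frontier X"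
proof (rule ccontr)
  assume "x \<notin> frontier X"
  then have "x \<in> interior X" using X(2) closure_subset by (auto simp: frontier_def)
  then obtain e where e: "e > 0" "ball x e \<subseteq> X" by (auto simp: mem_interior)
  have "x + (e/2) *\<^sub>R dir \<theta> \<in> X" using e by (intro subsetD[OF e(2)]) (simp add: dist_norm)
  from support_fun_upper[OF X(1) this, of \<theta>] show False
    using m e(1) by (simp add: inner_add_left inner_dir_dir)
qed

text \<open>A fine inscribed polygon comes close to both extreme points in each direction, so the variation
  of its projection is at least twice the width, up to a small error.\<close>

lemma integral_support_fun_le_length:
  assumes X: "compact X" "X \<noteq> {}" and g: "path g" "pathfinish g = pathstart g" "path_image g = frontier X"
    and L: "has_curve_length g L"
  shows "integral {0..2*pi} (support_fun X) \<le> L"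
proof -
  let ?h = "support_fun X"
  let ?I = "integral {0..2*pi} ?h"
  have hc: "continuous_on S ?h" for S by (rule continuous_on_support_fun[OF X])
  have hc': "continuous_on S (\<lambda>\<theta>. ?h (\<theta> + pi))" for S
    by (rule continuous_on_compose2[OF hc[of UNIV]]) (auto intro!: continuous_intros)
  have "?I \<le> L + \<epsilon>" if "\<epsilon> > 0" for \<epsilon>
  proof -
    \<comment> \<open>Chosen so that the errors in the widths contribute
      \<open>2 * pi * e = \<epsilon>\<close> to the final bound.\<close>
    define e where "e = \<epsilon> / (2 * pi)"
    have e: "e > 0" using that by (simp add: e_def)
    have "uniformly_continuous_on {0..1} g"
      using g(1) compact_uniformly_continuous unfolding path_def by blast
    then obtain d where d: "d > 0" "\<And>x y. x \<in> {0..1} \<Longrightarrow> y \<in> {0..1} \<Longrightarrow> dist y x < d \<Longrightarrow> dist (g y) (g x) < e"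
      unfolding uniformly_continuous_on_def using e by metis
    obtain N :: nat where N: "real N > 1 / d" using reals_Archimedean2 by blast
    have "0 < 1 / d" using d(1) by simp
    then have "0 < real N" using N by (rule less_trans)
    then have N0: "N > 0" by simp
    have Nd: "1 / real N < d" using N N0 d(1) by (simp add: field_simps)
    define t where "t i = real i / real N" for i :: nat
    have t: "t 0 = 0" "t N = 1" "\<And>i. t i \<le> t (Suc i)"
      using N0 by (auto simp: t_def divide_right_mono)
    \<comment> \<open>A frontier point is \<open>g \<tau>\<close> for some \<open>\<tau>\<close>;
      the last sample parameter not exceeding \<open>\<tau>\<close> is within \<open>d\<close> of
      it, so uniform continuity applies.\<close>
    have near: "\<exists>a\<le>N. dist (g (t a)) x < e" if "x \<in> frontier X" for x
    proof -
      have "x \<in> g ` {0..1}" using that unfolding g(3)[symmetric] path_image_def .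
      then obtain \<tau> where \<tau>: "\<tau> \<in> {0..1}" "x = g \<tau>" by (rule imageE)
      define a where "a = nat \<lfloor>\<tau> * real N\<rfloor>"
      have "0 \<le> \<tau> * real N" using \<tau> by simp
      then have "real a = of_int \<lfloor>\<tau> * real N\<rfloor>" by (simp add: a_def)
      then have a: "real a \<le> \<tau> * real N" "\<tau> * real N < real a + 1" by linarith+
      have "\<tau> * real N \<le> 1 * real N" using \<tau> by (intro mult_right_mono) auto
      then have aN: "a \<le> N" using a by linarith
      have "t a \<le> \<tau>" using a(1) N0 by (simp add: t_def pos_divide_le_eq)
      moreover have "\<tau> < (real a + 1) / real N" using a(2) N0 by (simp add: pos_less_divide_eq)
      then have "\<tau> < t a + 1 / real N" by (simp add: t_def add_divide_distrib)
      ultimately have "dist (t a) \<tau> < d" using Nd by (simp add: dist_real_def)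
      moreover have "t a \<in> {0..1}" using aN N0 by (simp add: t_def)
      ultimately have "dist (g (t a)) x < e" unfolding \<tau>(2) by (intro d(2) \<tau>(1))
      then show ?thesis using aN by blast
    qed
    have sees: "\<exists>a\<le>N. g (t a) \<bullet> dir \<theta> \<ge> ?h \<theta> - e" for \<theta>
    proof -
      obtain x where x: "x \<in> X" "x \<bullet> dir \<theta> = ?h \<theta>" using support_fun_attained[OF X] .
      obtain a where a: "a \<le> N" "dist (g (t a)) x < e"
        using near[OF maximizer_in_frontier[OF X(1) x]] by blast
      have "(x - g (t a)) \<bullet> dir \<theta> \<le> norm (x - g (t a))"
        using norm_cauchy_schwarz[of "x - g (t a)" "dir \<theta>"] by simp
      then have "g (t a) \<bullet> dir \<theta> \<ge> ?h \<theta> - e"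
        using a(2) x(2) by (simp add: dist_norm norm_minus_commute inner_diff_left)
      then show ?thesis using a(1) by blast
    qed
    define v where "v i = g (t (Suc i)) - g (t i)" for i
    have pt: "2 * (?h \<theta> + ?h (\<theta> + pi) - 2 * e) \<le> (\<Sum>i<N. \<bar>v i \<bullet> dir \<theta>\<bar>)" for \<theta>
    proof -
      obtain a where a: "a \<le> N" "g (t a) \<bullet> dir \<theta> \<ge> ?h \<theta> - e" using sees by blast
      obtain b where b: "b \<le> N" "g (t b) \<bullet> dir (\<theta> + pi) \<ge> ?h (\<theta> + pi) - e" using sees by blast
      have "g (t N) = g (t 0)" using g(2) t by (simp add: pathfinish_def pathstart_def)
      then have "2 * (g (t a) \<bullet> dir \<theta> - g (t b) \<bullet> dir \<theta>) \<le> (\<Sum>i<N. \<bar>v i \<bullet> dir \<theta>\<bar>)"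
        using closed_variation_ge[of "\<lambda>i. g (t i) \<bullet> dir \<theta>" N a b] a(1) b(1)
        by (simp add: v_def inner_diff_left)
      then show ?thesis using a(2) b(2) by (simp add: dir_pi)
    qed
    have "(\<lambda>\<theta>. 2 * (?h \<theta> + ?h (\<theta> + pi) - 2 * e)) integrable_on {0..2*pi}"
      by (intro integrable_continuous_real continuous_intros hc hc')
    then have "integral {0..2*pi} (\<lambda>\<theta>. 2 * (?h \<theta> + ?h (\<theta> + pi) - 2 * e)) \<le> integral {0..2*pi} (\<lambda>\<theta>. \<Sum>i<N. \<bar>v i \<bullet> dir \<theta>\<bar>)"
    proof (rule integral_le)
      show "(\<lambda>\<theta>. \<Sum>i<N. \<bar>v i \<bullet> dir \<theta>\<bar>) integrable_on {0..2*pi}"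
        by (intro integrable_continuous_real continuous_intros)
    qed (rule pt)
    also have "\<dots> = (\<Sum>i<N. integral {0..2*pi} (\<lambda>\<theta>. \<bar>v i \<bullet> dir \<theta>\<bar>))"
      by (intro integral_sum integrable_continuous_real continuous_intros) auto
    also have "\<dots> = 4 * (\<Sum>i<N. norm (v i))"
      by (simp add: integral_abs_inner_dir sum_distrib_left)
    also have "(\<Sum>i<N. norm (v i)) \<le> L"
    proof -
      have "(\<Sum>i<N. norm (v i)) \<in> variation_sums g"
        unfolding variation_sums_def v_def dist_norm[symmetric] using t by blast
      then show ?thesis using L cSup_upper unfolding has_curve_length_def by blast
    qed
    finally have le: "integral {0..2*pi} (\<lambda>\<theta>. 2 * (?h \<theta> + ?h (\<theta> + pi) - 2 * e)) \<le> 4 * L" by simp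
    have i1: "?h integrable_on {0..2*pi}" by (intro integrable_continuous_real hc)
    have i2: "(\<lambda>\<theta>. ?h (\<theta> + pi)) integrable_on {0..2*pi}"
      by (intro integrable_continuous_real hc')
    have "integral {0..2*pi} (\<lambda>\<theta>. ?h (\<theta> + pi)) = ?I"
      by (intro integral_periodic_shift hc support_fun_2pi) simp_all
    then have j2: "((\<lambda>\<theta>. ?h (\<theta> + pi)) has_integral ?I) {0..2*pi}"
      using integrable_integral[OF i2] by (simp only:)
    have j3: "((\<lambda>\<theta>. 2 * e) has_integral (2 * pi) * (2 * e)) {0..2*pi}"
      using has_integral_const_real[of "2 * e" 0 "2 * pi"] by simp
    have "((\<lambda>\<theta>. 2 * (?h \<theta> + ?h (\<theta> + pi) - 2 * e)) has_integral 2 * (?I + ?I - (2 * pi) * (2 * e))) {0..2*pi}"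
      by (intro has_integral_mult_right has_integral_diff has_integral_add integrable_integral[OF i1] j2 j3)
    with le have "2 * (?I + ?I - (2 * pi) * (2 * e)) \<le> 4 * L" by (simp only: integral_unique)
    moreover have "2 * pi * e = \<epsilon>" by (simp add: e_def)
    ultimately show ?thesis by (simp add: algebra_simps)
  qed
  then show ?thesis by (rule field_le_epsilon)
qed

section \<open>Buffon probabilities\<close>

text \<open>Convexity reduces the needle to its end point, so that needle events become overlaps of
  \<open>X\<close> with a translate.\<close>

lemma needle_subset_iff:
  assumes "convex X" "x \<in> X"
  shows "needle x l \<theta> \<subseteq> X \<longleftrightarrow> x + l *\<^sub>R dir \<theta> \<in> X"
  unfolding needle_def dir_def[symmetric]
  using assms closed_segment_subset[of x X "x + l *\<^sub>R dir \<theta>"] ends_in_segment(2)[of "x + l *\<^sub>R dir \<theta>" x] by blast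

text \<open>Fubini for the set of admissible pairs of a starting point and an angle: slices at fixed
  \<open>x\<close> have measure \<open>2 * pi\<close> times the pointwise probability, slices at
  fixed \<open>\<theta>\<close> have the overlap area.\<close>

lemma has_integral_shift_overlap:
  assumes X: "compact X" "convex X"
  shows "((\<lambda>\<theta>. measure lebesgue {x \<in> X. x + l *\<^sub>R dir \<theta> \<in> X}) has_integral
     (2 * pi * integral X (\<lambda>x. pointwise_prob X x l))) {0..2*pi}"
proof -
  define S where "S = {z :: (real^2) \<times> real. fst z \<in> X \<and> fst z + l *\<^sub>R dir (snd z) \<in> X \<and> snd z \<in> {0..<2*pi}}"
  have clX: "closed X" using X(1) by (rule compact_imp_closed)
  \<comment> \<open>The half-open range of angles makes \<open>S\<close> a closed set cut by a Borel
    strip; being also bounded, it has an integrable indicator.\<close>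
  have "S = (X \<times> UNIV) \<inter> ((\<lambda>z. fst z + l *\<^sub>R dir (snd z)) -` X) \<inter> (UNIV \<times> {0..<2*pi})"
    by (auto simp: S_def)
  moreover have "closed ((X \<times> (UNIV :: real set)))" by (intro closed_Times clX) simp
  moreover have "closed ((\<lambda>z :: (real^2) \<times> real. fst z + l *\<^sub>R dir (snd z)) -` X)"
    by (intro closed_vimage clX continuous_intros)
  moreover have "(UNIV :: (real^2) set) \<times> {0..<2*pi} \<in> sets borel"
    unfolding borel_prod[symmetric] by (intro pair_measureI) auto
  ultimately have Sb: "S \<in> sets borel" by (auto intro!: sets.Int borel_closed)
  have Sp: "S \<in> sets (lborel \<Otimes>\<^sub>M lborel)"
    using Sb by (simp only: lborel_prod sets_lborel)
  have "S \<subseteq> X \<times> {0..2*pi}" by (auto simp: S_def)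
  moreover have "bounded (X \<times> {0..2*pi})" by (intro bounded_Times compact_imp_bounded X) simp
  ultimately have "bounded S" using bounded_subset by blast
  then have "emeasure lborel S < \<infinity>" by (rule emeasure_bounded_finite)
  then have int: "integrable (lborel \<Otimes>\<^sub>M lborel) (indicat_real S)"
    using Sb by (simp add: lborel_prod integrable_indicator_iff)
  then have int': "integrable (lborel \<Otimes>\<^sub>M lborel) (case_prod (\<lambda>x \<theta>. indicat_real S (x, \<theta>)))"
    by simp
  define F where "F x = measure lborel {\<theta>. (x, \<theta>) \<in> S}" for x
  define G where "G \<theta> = measure lborel {x. (x, \<theta>) \<in> S}" for \<theta>
  have sF: "{\<theta>. (x, \<theta>) \<in> S} \<in> sets borel" for x
    using sets_Pair1[OF Sp, of x] by (simp add: vimage_def)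
  have sG: "{x. (x, \<theta>) \<in> S} \<in> sets borel" for \<theta>
    using sets_Pair2[OF Sp, of \<theta>] by (simp add: vimage_def)
  have F: "(\<integral>\<theta>. indicat_real S (x, \<theta>) \<partial>lborel) = F x" for x
  proof -
    have "(\<lambda>\<theta>. indicat_real S (x, \<theta>)) = indicat_real {\<theta>. (x, \<theta>) \<in> S}" by (auto simp: indicator_def)
    then show ?thesis by (simp add: F_def)
  qed
  have G: "(\<integral>x. indicat_real S (x, \<theta>) \<partial>lborel) = G \<theta>" for \<theta>
  proof -
    have "(\<lambda>x. indicat_real S (x, \<theta>)) = indicat_real {x. (x, \<theta>) \<in> S}" by (auto simp: indicator_def)
    then show ?thesis by (simp add: G_def)
  qed
  have iF: "integrable lborel F" using lborel_pair.integrable_fst[OF int'] by (simp add: F)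
  have iG: "integrable lborel G" using lborel_pair.integrable_snd[OF int'] by (simp add: G)
  have eq: "(\<integral>\<theta>. G \<theta> \<partial>lborel) = (\<integral>x. F x \<partial>lborel)"
    using lborel_pair.Fubini_integral[OF int'] by (simp only: F G)
  have FX: "F x = 2 * pi * pointwise_prob X x l" if "x \<in> X" for x
  proof -
    have "{\<theta> \<in> {0..<2*pi}. needle x l \<theta> \<subseteq> X} = {\<theta>. (x, \<theta>) \<in> S}"
      using that needle_subset_iff[OF X(2) that] by (auto simp: S_def)
    then show ?thesis using sF[of x] by (simp add: pointwise_prob_def F_def)
  qed
  \<comment> \<open>Slices over points outside \<open>X\<close> are empty, so the integral over the
    whole plane reduces to one over \<open>X\<close>.\<close>
  have F0: "F x = 0" if "x \<notin> X" for x using that by (simp add: F_def S_def)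
  have "(F has_integral (\<integral>x. F x \<partial>lborel)) UNIV" by (rule has_integral_integral_lborel[OF iF])
  moreover have "F = (\<lambda>x. if x \<in> X then 2 * pi * pointwise_prob X x l else 0)"
    by (rule ext) (simp add: FX F0)
  ultimately have "((\<lambda>x. if x \<in> X then 2 * pi * pointwise_prob X x l else 0) has_integral (\<integral>x. F x \<partial>lborel)) UNIV"
    by (simp only:)
  then have "((\<lambda>x. 2 * pi * pointwise_prob X x l) has_integral (\<integral>x. F x \<partial>lborel)) X"
    by (subst (asm) has_integral_restrict_UNIV)
  then have IF: "(\<integral>x. F x \<partial>lborel) = 2 * pi * integral X (\<lambda>x. pointwise_prob X x l)"
    by (metis integral_mult_right integral_unique)
  define Q where "Q \<theta> = measure lebesgue {x \<in> X. x + l *\<^sub>R dir \<theta> \<in> X}" for \<theta>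
  have "G \<theta> = (if \<theta> \<in> {0..<2*pi} then Q \<theta> else 0)" for \<theta>
  proof (cases "\<theta> \<in> {0..<2*pi}")
    case True
    then have "{x. (x, \<theta>) \<in> S} = {x \<in> X. x + l *\<^sub>R dir \<theta> \<in> X}" by (auto simp: S_def)
    then show ?thesis using True sG[of \<theta>] by (simp add: G_def Q_def)
  next
    case False
    then have "{x. (x, \<theta>) \<in> S} = {}" by (auto simp: S_def)
    then show ?thesis unfolding if_not_P[OF False] by (simp add: G_def)
  qed
  then have "G = (\<lambda>\<theta>. if \<theta> \<in> {0..<2*pi} then Q \<theta> else 0)" by (rule ext)
  moreover have "(G has_integral (\<integral>\<theta>. G \<theta> \<partial>lborel)) UNIV" by (rule has_integral_integral_lborel[OF iG])
  ultimately have "((\<lambda>\<theta>. if \<theta> \<in> {0..<2*pi} then Q \<theta> else 0) has_integral (\<integral>\<theta>. G \<theta> \<partial>lborel)) UNIV"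
    by (simp only:)
  \<comment> \<open>Adding the single angle \<open>2 * pi\<close> does not change the integral and
    gives the closed interval.\<close>
  then have "((\<lambda>\<theta>. if \<theta> \<in> {0..2*pi} then Q \<theta> else 0) has_integral (\<integral>\<theta>. G \<theta> \<partial>lborel)) UNIV"
    by (rule has_integral_spike_finite[of "{2*pi}", rotated 2]) auto
  then have "(Q has_integral (\<integral>\<theta>. G \<theta> \<partial>lborel)) {0..2*pi}"
    by (subst (asm) has_integral_restrict_UNIV)
  then show ?thesis unfolding Q_def eq IF .
qed

lemma has_integral_width:
  assumes X: "compact X" "X \<noteq> {}"
  shows "((\<lambda>\<theta>. support_fun X (\<theta> + pi/2) + support_fun X (\<theta> + pi/2 + pi)) has_integral
      2 * integral {0..2*pi} (support_fun X)) {0..2*pi}"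
proof -
  have shifted: "((\<lambda>\<theta>. support_fun X (\<theta> + c)) has_integral integral {0..2*pi} (support_fun X)) {0..2*pi}"
    if "0 \<le> c" "c \<le> 2*pi" for c
  proof -
    have "continuous_on {0..2*pi} (\<lambda>\<theta>. support_fun X (\<theta> + c))"
      by (rule continuous_on_compose2[OF continuous_on_support_fun[OF X, of UNIV]])
        (auto intro!: continuous_intros)
    then have "((\<lambda>\<theta>. support_fun X (\<theta> + c)) has_integral integral {0..2*pi} (\<lambda>\<theta>. support_fun X (\<theta> + c))) {0..2*pi}"
      by (intro integrable_integral integrable_continuous_real)
    also have "integral {0..2*pi} (\<lambda>\<theta>. support_fun X (\<theta> + c)) = integral {0..2*pi} (support_fun X)"
      by (intro integral_periodic_shift continuous_on_support_fun X support_fun_2pi that)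
    finally show ?thesis .
  qed
  have "((\<lambda>\<theta>. support_fun X (\<theta> + pi/2) + support_fun X (\<theta> + (pi/2 + pi))) has_integral
      integral {0..2*pi} (support_fun X) + integral {0..2*pi} (support_fun X)) {0..2*pi}"
    by (intro has_integral_add shifted) simp_all
  then show ?thesis by (simp only: add.assoc mult_2)
qed

lemma width_nonneg:
  assumes "compact X" "X \<noteq> {}"
  shows "0 \<le> support_fun X \<theta> + support_fun X (\<theta> + pi)"
proof -
  obtain x where x: "x \<in> X" using assms by auto
  show ?thesis
    using support_fun_upper[OF assms(1) x, of \<theta>] support_fun_upper[OF assms(1) x, of "\<theta> + pi"]
    unfolding dir_pi by simp
qed

text \<open>The disk has width 2 in every direction, so for each angle at most \<open>2 * l\<close>
  of its area \<open>pi\<close> is lost; averaging over the angles keeps this bound.\<close>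

lemma buffon_prob_disk_ge:
  assumes l: "l > 0"
  shows "1 - 2 * l / pi \<le> buffon_prob (cball 0 1) l"
proof -
  let ?D = "cball 0 1 :: (real^2) set"
  have D: "compact ?D" "convex ?D" "?D \<noteq> {}" by auto
  have area: "measure lebesgue ?D = pi"
    by (simp add: content_cball unit_ball_vol_2)
  have "pi - 2 * l \<le> measure lebesgue {x \<in> ?D. x + l *\<^sub>R dir \<theta> \<in> ?D}" for \<theta>
  proof -
    have "measure lebesgue (shift_loss ?D (l *\<^sub>R dir \<theta>)) \<le> (1 - - 1) * l"
    proof (rule measure_shift_loss_le[OF D(1,2) l _ D(3)])
      fix x assume "x \<in> ?D"
      then have "\<bar>x \<bullet> dir (\<theta> + pi/2)\<bar> \<le> 1"
        using Cauchy_Schwarz_ineq2[of x "dir (\<theta> + pi/2)"] by simp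
      then show "- 1 \<le> x \<bullet> dir (\<theta> + pi/2) \<and> x \<bullet> dir (\<theta> + pi/2) \<le> 1" by linarith
    qed
    then show ?thesis unfolding lmeasurable_shift_loss(2)[OF D(1)] area by simp
  qed
  moreover have "((\<lambda>\<theta>::real. pi - 2 * l) has_integral 2 * pi * (pi - 2 * l)) {0..2*pi}"
    using has_integral_const_real[of "pi - 2 * l" 0 "2*pi"] by simp
  ultimately have "2 * pi * (pi - 2 * l) \<le> 2 * pi * integral ?D (\<lambda>x. pointwise_prob ?D x l)"
    using has_integral_le[OF _ has_integral_shift_overlap[OF D(1,2)]] by blast
  then have "pi - 2 * l \<le> integral ?D (\<lambda>x. pointwise_prob ?D x l)" by simp
  then have "(pi - 2 * l) / pi \<le> integral ?D (\<lambda>x. pointwise_prob ?D x l) / pi"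
    by (intro divide_right_mono) auto
  then show ?thesis unfolding buffon_prob_def area by (simp add: diff_divide_distrib)
qed

text \<open>The area lost at angle \<open>\<theta>\<close> is at least
  \<open>(1 - l / r) * l\<close> times the width across \<open>dir \<theta>\<close>, and the widths
  integrate to twice the integral of the support function; dividing by \<open>2 * pi\<close> and by
  the area gives the subtracted term.\<close>

lemma buffon_prob_le:
  assumes X: "compact X" "convex X" and A: "measure lebesgue X > 0"
    and l: "l > 0" "l < r" and ball: "cball p r \<subseteq> X"
  shows "buffon_prob X l \<le> 1 - (1 - l / r) * l * integral {0..2*pi} (support_fun X) / (pi * measure lebesgue X)"
proof -
  let ?A = "measure lebesgue X" and ?I = "integral {0..2*pi} (support_fun X)"
  let ?w = "\<lambda>\<theta>. support_fun X (\<theta> + pi/2) + support_fun X (\<theta> + pi/2 + pi)"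
  have ne: "X \<noteq> {}" using A by auto
  have "measure lebesgue {x \<in> X. x + l *\<^sub>R dir \<theta> \<in> X} \<le> ?A - (1 - l / r) * l * ?w \<theta>" for \<theta>
    unfolding lmeasurable_shift_loss(2)[OF X(1)] using measure_shift_loss_ge[OF X l ball, of \<theta>] by simp
  moreover have "((\<lambda>\<theta>::real. ?A) has_integral 2 * pi * ?A) {0..2*pi}"
    using has_integral_const_real[of ?A 0 "2*pi"] by simp
  then have "((\<lambda>\<theta>. ?A - (1 - l / r) * l * ?w \<theta>) has_integral 2 * pi * ?A - (1 - l / r) * l * (2 * ?I)) {0..2*pi}"
    by (intro has_integral_diff has_integral_mult_right has_integral_width X(1) ne)
  ultimately have "2 * pi * integral X (\<lambda>x. pointwise_prob X x l) \<le> 2 * pi * ?A - (1 - l / r) * l * (2 * ?I)"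
    using has_integral_le[OF has_integral_shift_overlap[OF X]] by blast
  then have "integral X (\<lambda>x. pointwise_prob X x l) \<le> (2 * pi * ?A - (1 - l / r) * l * (2 * ?I)) / (2 * pi)"
    by (simp add: pos_le_divide_eq mult.commute)
  then have "buffon_prob X l \<le> (2 * pi * ?A - (1 - l / r) * l * (2 * ?I)) / (2 * pi) / ?A"
    unfolding buffon_prob_def by (rule divide_right_mono) (use A in simp)
  also have "\<dots> = 1 - (1 - l / r) * l * ?I / (pi * ?A)"
  proof -
    have "(2 * pi * a - u * (2 * i)) / (2 * pi) / a = 1 - u * i / (pi * a)" if "a > 0" for a u i :: real
      using that by (simp add: field_simps)
    then show ?thesis using A by simp
  qed
  finally show ?thesis .
qed

theorem theorem1:
  fixes X :: "(real^2) set"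
  assumes "compact X" and "convex X"
    and "boundary_length X (2*pi)"
    and "\<not> (\<exists>c r. X = cball c r)"
  shows "\<exists>\<epsilon>>0. \<forall>l\<in>{0<..<\<epsilon>}. buffon_prob X l < buffon_prob (cball 0 1) l"
proof (cases "measure lebesgue X = 0")
  \<comment> \<open>With zero area the quotient in \<open>buffon_prob\<close> is 0 by the convention
    for division by zero, while the bound for the disk is positive for \<open>l < 1\<close> because
    \<open>2 < pi\<close>.\<close>
  case True
  have "buffon_prob X l < buffon_prob (cball 0 1) l" if "l \<in> {0<..<1}" for l
  proof -
    have "2 * l < pi" using that pi_gt3 by simp
    then have "0 < 1 - 2 * l / pi" by (simp add: field_simps)
    also have "\<dots> \<le> buffon_prob (cball 0 1) l" using that by (intro buffon_prob_disk_ge) simp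
    finally show ?thesis using True by (simp add: buffon_prob_def)
  qed
  then show ?thesis by (intro exI[of _ 1]) simp
next
  case False
  let ?A = "measure lebesgue X" and ?I = "integral {0..2*pi} (support_fun X)"
  have A: "?A > 0" using False by (simp add: zero_less_measure_iff)
  then have ne: "X \<noteq> {}" by auto
  \<comment> \<open>A convex set of positive area has interior points, which supplies the ball
    required by \<open>buffon_prob_le\<close>.\<close>
  have "interior X \<noteq> {}"
    using False negligible_convex_interior[OF assms(2)] negligible_imp_measure0 by blast
  then obtain p r where r: "r > 0" "cball p r \<subseteq> X"
    by (metis all_not_in_conv mem_interior_cball)
  obtain g where g: "simple_path g" "pathfinish g = pathstart g" "path_image g = frontier X" "has_curve_length g (2*pi)"
    using assms(3) unfolding boundary_length_def by blast
  have I_le: "?I \<le> 2 * pi"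
    by (rule integral_support_fun_le_length[OF assms(1) ne simple_path_imp_path[OF g(1)] g(2-4)])
  have "0 \<le> 2 * ?I"
    by (rule has_integral_nonneg[OF has_integral_width[OF assms(1) ne]]) (rule width_nonneg[OF assms(1) ne])
  then have I_ge: "?I \<ge> 0" by simp
  \<comment> \<open>Since \<open>?I\<close> lies between 0 and \<open>2 * pi\<close>, one factor of
    its square is replaced by \<open>2 * pi\<close>; cancelling leaves
    \<open>2 * ?A < ?I\<close>.\<close>
  have "4 * pi * ?A < ?I\<^sup>2"
    using assms(4) by (intro mean_width_isoperimetric_strict assms(1,2) ne) blast
  also have "\<dots> \<le> 2 * pi * ?I"
    unfolding power2_eq_square using I_le I_ge by (rule mult_right_mono)
  finally have "2 * pi * (2 * ?A) < 2 * pi * ?I" by simp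
  then have AI: "2 * ?A < ?I" by (rule mult_left_less_imp_less) simp
  then have I: "?I > 0" using A by linarith
  \<comment> \<open>The condition \<open>l < \<epsilon>\<close> is equivalent to
    \<open>2 * ?A < (1 - l / r) * ?I\<close>, which for \<open>l > 0\<close> puts the upper bound
    for \<open>X\<close> strictly below the lower bound \<open>1 - 2 * l / pi\<close> for the
    disk.\<close>
  define \<epsilon> where "\<epsilon> = r * (1 - 2 * ?A / ?I)"
  have \<epsilon>: "\<epsilon> > 0" "\<epsilon> < r"
    unfolding \<epsilon>_def using r(1) AI I A by (simp_all add: field_simps)
  have "buffon_prob X l < buffon_prob (cball 0 1) l" if "l \<in> {0<..<\<epsilon>}" for l
  proof -
    have l: "l > 0" "l < r" using that \<epsilon> by auto
    have "l / r < 1 - 2 * ?A / ?I"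
      using that r(1) by (simp add: \<epsilon>_def pos_divide_less_eq mult.commute)
    then have "2 * ?A / ?I < 1 - l / r" by simp
    then have "2 * ?A < (1 - l / r) * ?I" using I by (simp only: pos_divide_less_eq)
    then have "l * (2 * ?A) < l * ((1 - l / r) * ?I)" using l(1) by (simp only: mult_less_cancel_left_pos)
    then have "l * (2 * ?A) / (pi * ?A) < l * ((1 - l / r) * ?I) / (pi * ?A)"
      using A by (intro divide_strict_right_mono) simp_all
    moreover have "l * (2 * ?A) / (pi * ?A) = 2 * l / pi" using A by simp
    moreover have "l * ((1 - l / r) * ?I) = (1 - l / r) * l * ?I" by simp
    ultimately have "1 - (1 - l / r) * l * ?I / (pi * ?A) < 1 - 2 * l / pi" by (simp only: diff_strict_left_mono)
    with buffon_prob_le[OF assms(1,2) A l r(2)] buffon_prob_disk_ge[OF l(1)] show ?thesis by linarith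
  qed
  then show ?thesis using \<epsilon>(1) by blast
qed

end
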